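(* Let $\rho>0$, $\beta>0$, $x_0>0$. The limit $$\lambda(\rho,\beta):=\lim_{n\to\infty}\frac1n\log\mathbb{E}[x_n]$$ (taken as $n\to\infty$ with $\beta=\frac12\sigma^2\tau n^2$ held fixed) exists and is given by the variational formula $$\lambda(\rho,\beta)=\sup_{g\in\mathcal{G}}\left\{g(1)\log\rho+\beta\int_0^1(g(1)-g(x))^2\,dx-\int_0^1 I(g'(x))\,dx\right\},$$ where $I(x):=x\log x+(1-x)\log(1-x)$ and $$\mathcal{G}:=\left\{g:[0,1]\to[0,1]:\ g(0)=0,\ g\text{ is absolutely continuous and }0\le g'\le 1\right\}.$$
   Context: Setup: for each $n\ge1$ the parameters $\sigma=\sigma_n>0$ and $\tau=\tau_n>0$ satisfy $\frac12\sigma_n^2\tau_n n^2=\beta$, with $\beta$ fixed. $W(t)$ is a standard Brownian motion started at $0$ at time $0$, $t_i=i\tau$, $W_i=W(t_i)$, and $a_i=1+\rho e^{\sigma W_i-\frac12\sigma^2t_i}$. The process is defined by $x_{i+1}=a_ix_i$ for $i\ge 0$, with deterministic initial value $x_0>0$; thus $x_n=x_0\prod_{i=0}^{n-1}a_i$, computed with parameters $\sigma_n,\tau_n$. Convention: $0\log 0=0$. The bound $0\le g'\le1$ is understood almost everywhere. *)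

theory Defs
  imports "HOL-Probability.Probability"
begin

definition standard_brownian_motion :: "'a measure \<Rightarrow> (real \<Rightarrow> 'a \<Rightarrow> real) \<Rightarrow> bool" where
  "standard_brownian_motion M W \<longleftrightarrow>
     prob_space M \<and>
     (\<forall>t\<ge>0. W t \<in> borel_measurable M) \<and>
     (AE \<omega> in M. W 0 \<omega> = 0) \<and>
     (\<forall>s t. 0 \<le> s \<and> s < t \<longrightarrow>
        distributed M lborel (\<lambda>\<omega>. W t \<omega> - W s \<omega>) (normal_density 0 (sqrt (t - s)))) \<and>
     (\<forall>(n::nat) (u::nat \<Rightarrow> real). 0 \<le> u 0 \<and> (\<forall>i<n. u i \<le> u (Suc i)) \<longrightarrow>
        prob_space.indep_vars M (\<lambda>_. borel) (\<lambda>i \<omega>. W (u (Suc i)) \<omega> - W (u i) \<omega>) {..<n}) \<and>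
     (AE \<omega> in M. continuous_on {0..} (\<lambda>t. W t \<omega>))"

definition growth_factor ::
  "real \<Rightarrow> real \<Rightarrow> real \<Rightarrow> (real \<Rightarrow> 'a \<Rightarrow> real) \<Rightarrow> nat \<Rightarrow> 'a \<Rightarrow> real" where
  "growth_factor \<rho> \<sigma> \<tau> W i \<omega> =
     1 + \<rho> * exp (\<sigma> * W (real i * \<tau>) \<omega> - \<sigma>\<^sup>2 / 2 * (real i * \<tau>))"

primrec growth_process ::
  "real \<Rightarrow> real \<Rightarrow> real \<Rightarrow> real \<Rightarrow> (real \<Rightarrow> 'a \<Rightarrow> real) \<Rightarrow> nat \<Rightarrow> 'a \<Rightarrow> real" where
  "growth_process \<rho> x0 \<sigma> \<tau> W 0 \<omega> = x0"
| "growth_process \<rho> x0 \<sigma> \<tau> W (Suc i) \<omega> =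
     growth_factor \<rho> \<sigma> \<tau> W i \<omega> * growth_process \<rho> x0 \<sigma> \<tau> W i \<omega>"

(* The convention 0 log 0 = 0 holds because the logarithms are multiplied by 0. *)
definition rate_fun :: "real \<Rightarrow> real" where
  "rate_fun x = x * ln x + (1 - x) * ln (1 - x)"

definition abs_continuous_on_interval :: "real \<Rightarrow> real \<Rightarrow> (real \<Rightarrow> real) \<Rightarrow> bool" where
  "abs_continuous_on_interval lo hi g \<longleftrightarrow>
     (\<forall>\<epsilon>>0. \<exists>\<delta>>0. \<forall>D :: (real \<times> real) set.
        finite D \<and> (\<forall>(a, b)\<in>D. lo \<le> a \<and> a < b \<and> b \<le> hi) \<and>
        disjoint_family_on (\<lambda>(a, b). {a<..<b}) D \<and> (\<Sum>(a, b)\<in>D. b - a) < \<delta>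
        \<longrightarrow> (\<Sum>(a, b)\<in>D. \<bar>g b - g a\<bar>) < \<epsilon>)"

(* Functions on [0,1] are represented by arbitrary extensions to the real line; the values
   outside [0,1] influence neither membership nor the functional below, since the
   derivative at interior points is local and the two endpoints form a null set. *)
definition admissible :: "(real \<Rightarrow> real) set" where
  "admissible = {g. g ` {0..1} \<subseteq> {0..1} \<and> g 0 = 0 \<and> abs_continuous_on_interval 0 1 g \<and>
     (AE x in lebesgue. x \<in> {0..1} \<longrightarrow>
        g differentiable (at x) \<and> 0 \<le> deriv g x \<and> deriv g x \<le> 1)}"

definition growth_functional :: "real \<Rightarrow> real \<Rightarrow> (real \<Rightarrow> real) \<Rightarrow> real" where
  "growth_functional \<rho> \<beta> g =
     g 1 * ln \<rho> + \<beta> * (LINT x:{0..1}|lebesgue. (g 1 - g x)\<^sup>2)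
     - (LINT x:{0..1}|lebesgue. rate_fun (deriv g x))"

end

theory Submission
  imports Defs "HOL-Real_Asymp.Real_Asymp"
begin

text \<open>
  Expand the product of the \<open>a\<^sub>i = 1 + \<rho> exp (...)\<close> over the sets \<open>S \<subseteq> {0, ..., n - 1}\<close> of indices where
  the exponential is selected. The Gaussian expectation of each term is explicit, and
  \<open>\<bbbE> x\<^sub>n = x\<^sub>0 * (\<Sum>S. \<rho> ^ |S| * exp ((\<beta> / n\<^sup>2) * (\<Sum>m<n. (k\<^sub>m)\<^sup>2 - k\<^sub>m)))\<close>,
  where \<open>k\<^sub>m\<close> is the number of elements of \<open>S\<close> above \<open>m\<close> (\<open>growth_process_moment\<close>). The terms linear in
  \<open>k\<^sub>m\<close> change the logarithm by at most \<open>\<beta>\<close>, so the claim concerns a lattice gas with a quadratic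
  mean-field energy (\<open>partition_sum\<close>).

  The energy is a convex quadratic function of the profile \<open>k\<close>. Since \<open>k\<^sup>2 \<ge> 2 k c - c\<^sup>2\<close>, with
  equality at \<open>k = c\<close>, it can be replaced by an energy that is linear in \<open>S\<close>, for which the sum over \<open>S\<close> is a product of factors \<open>1 + exp h\<close>; and \<open>ln (1 + exp h)\<close> is the supremum of
  \<open>p h - I(p)\<close> over \<open>0 \<le> p \<le> 1\<close>, which produces the entropy \<open>I\<close>.

  Lower bound: for an admissible \<open>g\<close>, linearising at the profile \<open>c = n (g(1) - g)\<close> and integrating
  \<open>g' h - I(g') \<le> ln (1 + exp h)\<close> over the cells of length \<open>1 / n\<close> shows that \<open>n F(g) - \<beta>\<close> is at most the
  logarithm of the partition sum for every \<open>n\<close>, where \<open>F\<close> is the functional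
  (\<open>growth_functional_le_ln_partition_sum\<close>). This needs that \<open>g\<close> is the integral of its derivative
  (\<open>abs_continuous_has_integral_derivative\<close>).

  Upper bound: the profiles of all sets lie within distance about \<open>sqrt n\<close> of a family of step profiles
  of size \<open>exp (o(n))\<close>. Linearising at the nearby step profile costs only a bounded factor, and the
  linearised sum is at most the exponential of the discrete functional at the maximising parameters
  \<open>p\<close> (\<open>ln_partition_sum_le\<close>). The piecewise linear function with slopes \<open>p\<close> is admissible and has at
  least that value (\<open>step_primitive_growth_functional\<close>).
\<close>

section \<open>Absolutely continuous functions on an interval\<close>

lemma abs_continuous_on_intervalE:
  assumes "abs_continuous_on_interval lo hi g" "\<epsilon> > 0"
  obtains \<delta> where "\<delta> > 0" "\<And>D. finite D \<Longrightarrow> (\<And>a b. (a, b) \<in> D \<Longrightarrow> lo \<le> a \<and> a < b \<and> b \<le> hi) \<Longrightarrow>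
      disjoint_family_on (\<lambda>(a, b). {a<..<b}) D \<Longrightarrow> (\<Sum>(a, b)\<in>D. b - a) < \<delta> \<Longrightarrow>
      (\<Sum>(a, b)\<in>D. \<bar>g b - g a\<bar>) < \<epsilon>"
proof -
  obtain \<delta> where 1: "\<delta> > 0" and 2: "\<forall>D. finite D \<and> (\<forall>(a, b)\<in>D. lo \<le> a \<and> a < b \<and> b \<le> hi) \<and>
        disjoint_family_on (\<lambda>(a, b). {a<..<b}) D \<and> (\<Sum>(a, b)\<in>D. b - a) < \<delta>
        \<longrightarrow> (\<Sum>(a, b)\<in>D. \<bar>g b - g a\<bar>) < \<epsilon>"
    using assms(1)[unfolded abs_continuous_on_interval_def, THEN spec, THEN mp, OF assms(2)] by blast
  show thesis
    by (rule that[OF 1], rule 2[THEN spec, THEN mp]) blast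
qed

lemma abs_continuous_on_interval_subset:
  assumes "abs_continuous_on_interval lo hi g" "lo \<le> a" "b \<le> hi"
  shows "abs_continuous_on_interval a b g"
  unfolding abs_continuous_on_interval_def
proof (intro allI impI)
  fix \<epsilon> :: real assume "\<epsilon> > 0"
  from abs_continuous_on_intervalE[OF assms(1) this] obtain \<delta> where "\<delta> > 0"
    and \<delta>: "\<And>D. finite D \<Longrightarrow> (\<And>a b. (a, b) \<in> D \<Longrightarrow> lo \<le> a \<and> a < b \<and> b \<le> hi) \<Longrightarrow>
      disjoint_family_on (\<lambda>(a, b). {a<..<b}) D \<Longrightarrow> (\<Sum>(a, b)\<in>D. b - a) < \<delta> \<Longrightarrow>
      (\<Sum>(a, b)\<in>D. \<bar>g b - g a\<bar>) < \<epsilon>"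
    by blast
  show "\<exists>\<delta>>0. \<forall>D. finite D \<and> (\<forall>(c, d)\<in>D. a \<le> c \<and> c < d \<and> d \<le> b) \<and>
        disjoint_family_on (\<lambda>(a, b). {a<..<b}) D \<and> (\<Sum>(a, b)\<in>D. b - a) < \<delta>
        \<longrightarrow> (\<Sum>(a, b)\<in>D. \<bar>g b - g a\<bar>) < \<epsilon>"
  proof (intro exI[of _ \<delta>] conjI allI impI \<open>\<delta> > 0\<close>; elim conjE)
    fix D :: "(real \<times> real) set"
    assume "finite D" "\<forall>(c, d)\<in>D. a \<le> c \<and> c < d \<and> d \<le> b"
      "disjoint_family_on (\<lambda>(a, b). {a<..<b}) D" "(\<Sum>(a, b)\<in>D. b - a) < \<delta>"
    moreover from this(2) have "lo \<le> c \<and> c < d \<and> d \<le> hi" if "(c, d) \<in> D" for c d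
      using assms(2,3) that by fastforce
    ultimately show "(\<Sum>(a, b)\<in>D. \<bar>g b - g a\<bar>) < \<epsilon>"
      by (intro \<delta>)
  qed
qed

text \<open>
  The fundamental theorem of calculus for absolutely continuous functions, in the Henstock-Kurzweil
  setting, where the gauge can be chosen directly. At a point of differentiability the gauge makes the
  linear approximation accurate. At a point of the exceptional null set \<open>N\<close> it keeps the cell inside an
  open superset of \<open>N\<close> of small measure; the cells tagged there do not overlap and have small
  total length, so absolute continuity bounds the increments of \<open>g\<close> over them.
\<close>

lemma abs_continuous_has_integral_derivative:
  fixes g g' :: "real \<Rightarrow> real"
  assumes "a \<le> b" and ac: "abs_continuous_on_interval a b g" and N: "negligible N"
    and der: "\<And>x. x \<in> {a..b} - N \<Longrightarrow> (g has_real_derivative g' x) (at x within {a..b})"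
  shows "(g' has_integral (g b - g a)) {a..b}"
proof (cases "a = b")
  case False
  with \<open>a \<le> b\<close> have "a < b" by simp
  \<comment> \<open>Setting the integrand to \<open>0\<close> on \<open>N\<close> removes the cells tagged in \<open>N\<close> from the Riemann sum.\<close>
  define h where "h x = (if x \<in> N then 0 else g' x)" for x
  have "(h has_integral (g b - g a)) {a..b}"
    unfolding has_integral_factor_content_real
  proof (intro allI impI)
    fix e :: real assume "e > 0"
    have "e * (b - a) / 2 > 0" using \<open>e > 0\<close> \<open>a < b\<close> by simp
    from abs_continuous_on_intervalE[OF ac this] obtain \<delta> where "\<delta> > 0"
      and \<delta>: "\<And>D. finite D \<Longrightarrow> (\<And>c d. (c, d) \<in> D \<Longrightarrow> a \<le> c \<and> c < d \<and> d \<le> b) \<Longrightarrow>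
        disjoint_family_on (\<lambda>(a, b). {a<..<b}) D \<Longrightarrow> (\<Sum>(a, b)\<in>D. b - a) < \<delta> \<Longrightarrow>
        (\<Sum>(a, b)\<in>D. \<bar>g b - g a\<bar>) < e * (b - a) / 2"
      by blast
    obtain U where U: "open U" "N \<subseteq> U" "U \<in> lmeasurable" "measure lebesgue U < \<delta>"
    proof -
      have NN: "N \<in> null_sets lebesgue" using N by (simp add: negligible_iff_null_sets)
      obtain U where U: "open U" "N \<subseteq> U" "U - N \<in> lmeasurable" "emeasure lebesgue (U - N) < ennreal \<delta>"
        using sets_lebesgue_outer_open[of N \<delta>] NN \<open>\<delta> > 0\<close> by auto
      have "emeasure lebesgue U = emeasure lebesgue (U - N)"
        using emeasure_Diff_null_set[OF NN, of U] U(1) by auto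
      then have "emeasure lebesgue U < ennreal \<delta>" using U(4) by simp
      moreover have "U \<in> sets lebesgue" using U(1) by simp
      ultimately have Um: "U \<in> lmeasurable"
        by (intro fmeasurableI) (auto intro: less_trans)
      then have "measure lebesgue U < \<delta>"
        using \<open>emeasure lebesgue U < ennreal \<delta>\<close> by (simp add: emeasure_eq_measure2 ennreal_less_iff)
      then show thesis using that U Um by blast
    qed
    have "\<exists>d>0. (x \<in> N \<longrightarrow> ball x d \<subseteq> U) \<and> (x \<in> {a..b} - N \<longrightarrow>
         (\<forall>y\<in>{a..b}. \<bar>y - x\<bar> < d \<longrightarrow> \<bar>g y - g x - (y - x) * g' x\<bar> \<le> e / 2 * \<bar>y - x\<bar>))" for x
    proof (cases "x \<in> N")
      case True
      then show ?thesis using U(1,2) open_contains_ball by (metis DiffE subsetD)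
    next
      case nN: False
      show ?thesis
      proof (cases "x \<in> {a..b}")
        case True
        then have "(g has_derivative (\<lambda>y. y * g' x)) (at x within {a..b})"
          using der[of x] nN by (simp add: has_field_derivative_def mult_commute_abs)
        then obtain d where "d > 0"
          "\<forall>y\<in>{a..b}. norm (y - x) < d \<longrightarrow> norm (g y - g x - (y - x) * g' x) \<le> e / 2 * norm (y - x)"
          unfolding has_derivative_within_alt using \<open>e > 0\<close> half_gt_zero by blast
        then show ?thesis using nN by auto
      qed (use nN in \<open>auto intro: exI[of _ 1]\<close>)
    qed
    then obtain d where d: "\<And>x. d x > 0" "\<And>x. x \<in> N \<Longrightarrow> ball x (d x) \<subseteq> U"
      "\<And>x y. x \<in> {a..b} - N \<Longrightarrow> y \<in> {a..b} \<Longrightarrow> \<bar>y - x\<bar> < d x \<Longrightarrow>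
         \<bar>g y - g x - (y - x) * g' x\<bar> \<le> e / 2 * \<bar>y - x\<bar>"
      by metis
    show "\<exists>\<gamma>. gauge \<gamma> \<and> (\<forall>p. p tagged_division_of {a..b} \<and> \<gamma> fine p \<longrightarrow>
        norm ((\<Sum>(x, K)\<in>p. measure lborel K *\<^sub>R h x) - (g b - g a)) \<le> e * measure lborel {a..b})"
    proof (intro exI[of _ "\<lambda>x. ball x (d x)"] conjI allI impI; (elim conjE)?)
      show "gauge (\<lambda>x. ball x (d x))" using d(1) gauge_ball_dependent by blast
    next
      fix p assume p: "p tagged_division_of {a..b}" and fine: "(\<lambda>x. ball x (d x)) fine p"
      note pD = tagged_division_ofD[OF p]
      have K: "\<exists>u v. K = {u..v} \<and> u \<le> v \<and> a \<le> u \<and> v \<le> b \<and> x \<in> {u..v} \<and> {u..v} \<subseteq> ball x (d x)"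
        if xK: "(x, K) \<in> p" for x K
      proof -
        obtain u v where uv: "K = {u..v}" using pD(4)[OF xK] by auto
        then have "x \<in> {u..v}" using pD(2)[OF xK] by simp
        moreover from this have "u \<le> v" by simp
        moreover have "a \<le> u" "v \<le> b" using pD(3)[OF xK] uv \<open>u \<le> v\<close> by auto
        moreover have "{u..v} \<subseteq> ball x (d x)" using fineD[OF fine xK] uv by simp
        ultimately show ?thesis using uv by blast
      qed
      define dg where "dg t = (case t of (x, K) \<Rightarrow> g (Sup K) - g (Inf K))" for t :: "real \<times> real set"
      define len where "len t = (case t of (x, K) \<Rightarrow> Sup K - Inf K)" for t :: "real \<times> real set"
      have sums: "(\<Sum>t\<in>p. dg t) = g b - g a" "(\<Sum>t\<in>p. len t) = b - a"
        using additive_tagged_division_1[OF \<open>a \<le> b\<close> p, of g]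
          additive_tagged_division_1[OF \<open>a \<le> b\<close> p, of "\<lambda>x. x"]
        unfolding dg_def len_def by simp_all
      have len0: "len t \<ge> 0" if "t \<in> p" for t
        using K[of "fst t" "snd t"] that by (cases t) (auto simp: len_def)
      \<comment> \<open>Degenerate cells are left out, so that distinct cells have distinct end points.\<close>
      define q where "q = {t \<in> p. fst t \<in> N \<and> len t > 0}"
      have finq: "finite q" unfolding q_def using pD(1) by simp
      define ends where "ends t = (case t of (x :: real, K) \<Rightarrow> (Inf K, Sup K :: real))" for t
      have qK: "snd t = {fst (ends t)..snd (ends t)} \<and> fst (ends t) < snd (ends t) \<and>
          a \<le> fst (ends t) \<and> snd (ends t) \<le> b \<and> {fst (ends t)..snd (ends t)} \<subseteq> U" if "t \<in> q" for t
      proof (cases t)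
        case (Pair x K)
        with that have "(x, K) \<in> p" "x \<in> N" "len (x, K) > 0" unfolding q_def by auto
        then obtain u v where "K = {u..v}" "u \<le> v" "a \<le> u" "v \<le> b" "{u..v} \<subseteq> ball x (d x)"
          using K by blast
        moreover have "ball x (d x) \<subseteq> U" by (rule d) fact
        ultimately show ?thesis using \<open>len (x, K) > 0\<close> Pair by (auto simp: ends_def len_def)
      qed
      have disj: "{fst (ends s)<..<snd (ends s)} \<inter> {fst (ends t)<..<snd (ends t)} = {}"
        if "s \<in> q" "t \<in> q" "s \<noteq> t" for s t
      proof -
        have "interior (snd s) \<inter> interior (snd t) = {}"
          using pD(5)[of "fst s" "snd s" "fst t" "snd t"] that unfolding q_def by auto
        then show ?thesis using qK that by (metis interior_atLeastAtMost_real)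
      qed
      have inj: "inj_on ends q"
      proof (rule inj_onI, rule ccontr)
        fix s t assume st: "s \<in> q" "t \<in> q" "ends s = ends t" "s \<noteq> t"
        then have "{fst (ends s)<..<snd (ends s)} = {}" using disj[OF st(1,2,4)] by simp
        then show False using qK[OF st(1)] by simp
      qed
      have "(\<Sum>t\<in>q. len t) = (\<Sum>t\<in>q. measure lebesgue {fst (ends t)<..<snd (ends t)})"
      proof (rule sum.cong[OF refl])
        fix t assume "t \<in> q"
        then show "len t = measure lebesgue {fst (ends t)<..<snd (ends t)}"
          using qK[OF \<open>t \<in> q\<close>] by (cases t) (auto simp: len_def ends_def)
      qed
      also have "\<dots> = measure lebesgue (\<Union>t\<in>q. {fst (ends t)<..<snd (ends t)})"
        by (rule measure_negligible_finite_Union_image[symmetric])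
          (use finq disj in \<open>auto simp: pairwise_def\<close>)
      also have "\<dots> \<le> measure lebesgue U"
      proof (rule measure_mono_fmeasurable[OF _ _ U(3)])
        show "(\<Union>t\<in>q. {fst (ends t)<..<snd (ends t)}) \<subseteq> U"
          using qK greaterThanLessThan_subseteq_atLeastAtMost_iff by (intro UN_least) fastforce
      qed (use finq in auto)
      finally have "(\<Sum>t\<in>q. len t) < \<delta>" using U(4) by simp
      then have "(\<Sum>(c, d)\<in>ends ` q. d - c) < \<delta>"
        unfolding sum.reindex[OF inj] by (simp add: o_def len_def ends_def case_prod_beta)
      then have "(\<Sum>(c, d)\<in>ends ` q. \<bar>g d - g c\<bar>) < e * (b - a) / 2"
      proof (intro \<delta>)
        show "a \<le> c \<and> c < d \<and> d \<le> b" if cd: "(c, d) \<in> ends ` q" for c d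
        proof -
          obtain t where "t \<in> q" "ends t = (c, d)" using cd by force
          then show ?thesis using qK[of t] by simp
        qed
        show "disjoint_family_on (\<lambda>(a, b). {a<..<b}) (ends ` q)"
          using disj unfolding disjoint_family_on_def by (auto simp: case_prod_beta)
      qed (use finq in auto)
      then have small: "(\<Sum>t\<in>q. \<bar>dg t\<bar>) < e * (b - a) / 2"
        unfolding sum.reindex[OF inj] by (simp add: o_def dg_def ends_def case_prod_beta)
      have *: "\<bar>measure lborel (snd t) * h (fst t) - dg t\<bar> \<le> (if t \<in> q then \<bar>dg t\<bar> else 0) + e / 2 * len t"
        if "t \<in> p" for t
      proof (cases t)
        case (Pair x K)
        then have xK: "(x, K) \<in> p" using that by simp
        obtain u v where uv: "K = {u..v}" "u \<le> v" "a \<le> u" "v \<le> b" "x \<in> {u..v}" "{u..v} \<subseteq> ball x (d x)"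
          using K[OF xK] by blast
        have L: "len t = v - u" "dg t = g v - g u" "fst t = x" "snd t = K"
          using uv Pair by (auto simp: len_def dg_def)
        have "0 \<le> e / 2 * (v - u)" using \<open>e > 0\<close> uv(2) by simp
        show ?thesis
        proof (cases "x \<in> N")
          case True
          show ?thesis
          proof (cases "u = v")
            case True then show ?thesis unfolding L using uv(1) by simp
          next
            case False
            then have "t \<in> q" using that True uv(2) unfolding q_def by (simp add: L)
            then show ?thesis using \<open>0 \<le> e / 2 * (v - u)\<close> True unfolding L by (simp add: h_def)
          qed
        next
          case False
          then have xab: "x \<in> {a..b} - N" using uv by auto
          have "u \<in> ball x (d x)" "v \<in> ball x (d x)" using uv(2,6) by auto
          then have "\<bar>u - x\<bar> < d x" "\<bar>v - x\<bar> < d x" by (auto simp: dist_real_def)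
          then have "\<bar>g u - g x - (u - x) * g' x\<bar> \<le> e / 2 * \<bar>u - x\<bar>"
            "\<bar>g v - g x - (v - x) * g' x\<bar> \<le> e / 2 * \<bar>v - x\<bar>"
            using uv by (intro d(3)[OF xab]; simp)+
          moreover have "(v - u) * g' x - (g v - g u)
              = (g u - g x - (u - x) * g' x) - (g v - g x - (v - x) * g' x)"
            by (simp add: algebra_simps)
          ultimately have "\<bar>(v - u) * g' x - (g v - g u)\<bar> \<le> e / 2 * \<bar>u - x\<bar> + e / 2 * \<bar>v - x\<bar>"
            by linarith
          also have "\<dots> = e / 2 * (v - u)" using uv(5) by (simp add: field_simps)
          finally show ?thesis using False uv(1,2) unfolding q_def by (simp add: L h_def)
        qed
      qed
      have "\<bar>(\<Sum>t\<in>p. measure lborel (snd t) * h (fst t)) - (g b - g a)\<bar>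
          = \<bar>\<Sum>t\<in>p. measure lborel (snd t) * h (fst t) - dg t\<bar>"
        using sums(1) by (simp add: sum_subtractf)
      also have "\<dots> \<le> (\<Sum>t\<in>p. (if t \<in> q then \<bar>dg t\<bar> else 0) + e / 2 * len t)"
        using * by (intro order_trans[OF sum_abs] sum_mono) auto
      also have "\<dots> = (\<Sum>t\<in>q. \<bar>dg t\<bar>) + e / 2 * (b - a)"
      proof -
        have "p \<inter> q = q" unfolding q_def by blast
        then show ?thesis
          unfolding sum.distrib sum.inter_restrict[OF pD(1), symmetric] sum_distrib_left[symmetric] sums(2)
          by simp
      qed
      also have "\<dots> \<le> e * (b - a)" using small by simp
      finally show "norm ((\<Sum>(x, K)\<in>p. measure lborel K *\<^sub>R h x) - (g b - g a)) \<le> e * measure lborel {a..b}"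
        using \<open>a \<le> b\<close> by (simp add: case_prod_beta)
    qed
  qed
  then show ?thesis
    by (rule has_integral_spike[OF N, rotated]) (simp add: h_def)
qed (simp add: has_integral_refl)

lemma lipschitz_imp_abs_continuous:
  assumes "\<And>x y. \<bar>g y - g x\<bar> \<le> L * \<bar>y - x\<bar>" "L > 0"
  shows "abs_continuous_on_interval lo hi g"
  unfolding abs_continuous_on_interval_def
proof (intro allI impI)
  fix \<epsilon> :: real assume "\<epsilon> > 0"
  show "\<exists>\<delta>>0. \<forall>D. finite D \<and> (\<forall>(a, b)\<in>D. lo \<le> a \<and> a < b \<and> b \<le> hi) \<and>
        disjoint_family_on (\<lambda>(a, b). {a<..<b}) D \<and> (\<Sum>(a, b)\<in>D. b - a) < \<delta>
        \<longrightarrow> (\<Sum>(a, b)\<in>D. \<bar>g b - g a\<bar>) < \<epsilon>"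
  proof (intro exI[of _ "\<epsilon> / L"] conjI allI impI; (elim conjE)?)
    show "0 < \<epsilon> / L" using \<open>\<epsilon> > 0\<close> \<open>L > 0\<close> by simp
    fix D assume ord: "\<forall>(a, b)\<in>D. lo \<le> a \<and> a < b \<and> b \<le> hi" and small: "(\<Sum>(a, b)\<in>D. b - a) < \<epsilon> / L"
    have "(\<Sum>(a, b)\<in>D. \<bar>g b - g a\<bar>) \<le> (\<Sum>(a, b)\<in>D. L * (b - a))"
    proof (rule sum_mono)
      fix t assume "t \<in> D"
      obtain a b where t: "t = (a, b)" by (cases t)
      then have "a < b" using ord \<open>t \<in> D\<close> by auto
      then show "(case t of (a, b) \<Rightarrow> \<bar>g b - g a\<bar>) \<le> (case t of (a, b) \<Rightarrow> L * (b - a))"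
        using assms(1)[of b a] t by simp
    qed
    also have "\<dots> = L * (\<Sum>(a, b)\<in>D. b - a)" by (simp add: sum_distrib_left case_prod_beta)
    also have "\<dots> < \<epsilon>" using small \<open>L > 0\<close> by (simp add: field_simps)
    finally show "(\<Sum>(a, b)\<in>D. \<bar>g b - g a\<bar>) < \<epsilon>" .
  qed
qed

section \<open>The partition sum and its linearisation\<close>

text \<open>
  With \<open>p\<close> the indicator of a set \<open>S\<close> of sites this counts the elements of \<open>S\<close> above \<open>m\<close>; with
  \<open>p i = g ((i + 1) / n) - g (i / n)\<close> it is \<open>g 1 - g ((m + 1) / n)\<close>. It is the discrete form of the
  quantity \<open>g 1 - g x\<close> in the functional.
\<close>

definition tail_sum :: "(nat \<Rightarrow> real) \<Rightarrow> nat \<Rightarrow> nat \<Rightarrow> real" where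
  "tail_sum p n m = (\<Sum>i\<in>{m<..<n}. p i)"

text \<open>
  For \<open>a = \<beta> / n\<^sup>2\<close>, \<open>\<bbbE> x\<^sub>n / x\<^sub>0\<close> is this sum times a factor between \<open>exp (- \<beta>)\<close> and \<open>1\<close>. It is the partition
  function of a lattice gas on \<open>n\<close> sites with fugacity \<open>\<rho>\<close> and a quadratic attraction.
\<close>

definition partition_sum :: "real \<Rightarrow> real \<Rightarrow> nat \<Rightarrow> real" where
  "partition_sum \<rho> a n =
     (\<Sum>S\<in>Pow {..<n}. \<rho> ^ card S * exp (a * (\<Sum>m<n. (tail_sum (indicator S) n m)\<^sup>2)))"

text \<open>
  The mean-field energy plus entropy of the product of Bernoulli measures with parameters \<open>p i\<close>.
\<close>

definition discrete_functional :: "real \<Rightarrow> real \<Rightarrow> nat \<Rightarrow> (nat \<Rightarrow> real) \<Rightarrow> real" where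
  "discrete_functional \<rho> a n p =
     (\<Sum>i<n. p i) * ln \<rho> + a * (\<Sum>m<n. (tail_sum p n m)\<^sup>2) - (\<Sum>i<n. rate_fun (p i))"

lemma tail_sum_adjoint:
  "(\<Sum>m<n. c m * tail_sum p n m) = (\<Sum>i<n. p i * (\<Sum>m<i. c m))"
proof -
  have "(\<Sum>m<n. c m * tail_sum p n m) = (\<Sum>m<n. \<Sum>i<n. if m < i then c m * p i else 0)"
    unfolding tail_sum_def sum_distrib_left
    by (intro sum.cong[OF refl] sum.mono_neutral_cong_left) auto
  also have "\<dots> = (\<Sum>i<n. \<Sum>m<n. if m < i then c m * p i else 0)"
    by (rule sum.swap)
  also have "\<dots> = (\<Sum>i<n. p i * (\<Sum>m<i. c m))"
    unfolding sum_distrib_left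
    by (intro sum.cong[OF refl] sum.mono_neutral_cong_right) auto
  finally show ?thesis .
qed

lemma tail_sum_indicator_card:
  "tail_sum (indicator S) n m = real (card (S \<inter> {m<..<n}))"
  unfolding tail_sum_def by (simp add: indicator_def sum.If_cases Int_commute Int_def)

text \<open>
  The functions \<open>rate_fun\<close> on \<open>[0, 1]\<close> and \<open>h \<mapsto> ln (1 + exp h)\<close> are convex conjugates. The inequality
  is the nonnegativity of the relative entropy of a Bernoulli variable with parameter \<open>x\<close> with respect
  to one with the logistic parameter \<open>s = exp h / (1 + exp h)\<close>; equality holds at \<open>x = s\<close>.
\<close>

lemma rate_fun_dual:
  assumes "0 \<le> x" "x \<le> 1"
  shows "x * h - rate_fun x \<le> ln (1 + exp h)"
proof -
  have key: "x * ln t - x * ln x \<le> t - x" if "t > 0" "0 \<le> x" for x t :: real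
  proof (cases "x = 0")
    case False
    then have "x > 0" using that by simp
    then have "ln (t / x) \<le> t / x - 1" using that by (intro ln_le_minus_one) simp
    then have "x * ln (t / x) \<le> x * (t / x - 1)" using \<open>x > 0\<close> by (intro mult_left_mono) auto
    then show ?thesis using \<open>x > 0\<close> that by (simp add: ln_div algebra_simps)
  qed (use that in simp)
  define s where "s = exp h / (1 + exp h)"
  have pos: "1 + exp h > 0" by (simp add: add_pos_pos)
  have s: "s > 0" "1 - s > 0" "ln s = h - ln (1 + exp h)" "ln (1 - s) = - ln (1 + exp h)"
  proof -
    show "s > 0" unfolding s_def using pos by simp
    have *: "1 - s = 1 / (1 + exp h)" unfolding s_def using pos by (simp add: field_simps)
    show "1 - s > 0" unfolding * using pos by simp
    show "ln s = h - ln (1 + exp h)" unfolding s_def using pos by (simp add: ln_div)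
    show "ln (1 - s) = - ln (1 + exp h)" unfolding * using pos by (simp add: ln_div)
  qed
  have "x * ln s - x * ln x + ((1 - x) * ln (1 - s) - (1 - x) * ln (1 - x)) \<le> (s - x) + ((1 - s) - (1 - x))"
    using assms s(1,2) by (intro add_mono key) auto
  then show ?thesis unfolding s(3,4) rate_fun_def by (simp add: algebra_simps)
qed

lemma rate_fun_dual_eq:
  obtains x where "0 \<le> x" "x \<le> 1" "ln (1 + exp h) = x * h - rate_fun x"
proof
  define s where "s = exp h / (1 + exp h)"
  have pos: "1 + exp h > 0" by (simp add: add_pos_pos)
  have *: "1 - s = 1 / (1 + exp h)" unfolding s_def using pos by (simp add: field_simps)
  have "ln s = h - ln (1 + exp h)" unfolding s_def using pos by (simp add: ln_div)
  moreover have "ln (1 - s) = - ln (1 + exp h)" unfolding * using pos by (simp add: ln_div)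
  ultimately show "ln (1 + exp h) = s * h - rate_fun s"
    unfolding rate_fun_def by (simp only:) (simp add: algebra_simps)
  show "0 \<le> s" "s \<le> 1" unfolding s_def using pos by (simp_all add: field_simps)
qed

text \<open>
  Once the quadratic energy has been replaced by a linear one the sites decouple, and the sum over all
  subsets factorises.
\<close>

lemma linearised_partition_sum:
  assumes "\<rho> > 0"
  shows "(\<Sum>S\<in>Pow {..<n}. \<rho> ^ card S * exp (a * (\<Sum>m<n. 2 * c m * tail_sum (indicator S) n m)))
    = (\<Prod>i<n. 1 + exp (ln \<rho> + 2 * a * (\<Sum>m<i. c m)))"
proof -
  have "(\<Prod>i<n. exp (ln \<rho> + 2 * a * (\<Sum>m<i. c m)) + 1)
      = (\<Sum>S\<in>Pow {..<n}. \<Prod>i\<in>S. exp (ln \<rho> + 2 * a * (\<Sum>m<i. c m)))"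
    by (simp add: prod_add)
  also have "\<dots> = (\<Sum>S\<in>Pow {..<n}. \<rho> ^ card S * exp (a * (\<Sum>m<n. 2 * c m * tail_sum (indicator S) n m)))"
  proof (rule sum.cong[OF refl])
    fix S assume "S \<in> Pow {..<n}"
    then have S: "S \<subseteq> {..<n}" "finite S" using finite_subset by auto
    have "(\<Sum>m<n. 2 * c m * tail_sum (indicator S) n m) = (\<Sum>i<n. indicator S i * (\<Sum>m<i. 2 * c m))"
      by (rule tail_sum_adjoint)
    also have "\<dots> = (\<Sum>i\<in>S. 2 * (\<Sum>m<i. c m))"
      using S by (intro sum.mono_neutral_cong_right) (auto simp: sum_distrib_left)
    finally show "(\<Prod>i\<in>S. exp (ln \<rho> + 2 * a * (\<Sum>m<i. c m)))
        = \<rho> ^ card S * exp (a * (\<Sum>m<n. 2 * c m * tail_sum (indicator S) n m))"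
      using S assms by (simp add: exp_add prod.distrib exp_sum sum_distrib_left mult_ac)
  qed
  finally show ?thesis by (simp add: add.commute)
qed

text \<open>
  A convex quadratic energy lies above its tangents. Both bounds on the partition function rest on this
  inequality: for the lower bound the tangent replaces the energy of a set, for the upper bound it
  replaces the energy of the optimal Bernoulli parameters.
\<close>

lemma square_sum_ge_linearisation:
  fixes a :: real
  assumes "a \<ge> 0"
  shows "a * ((\<Sum>m\<in>A. 2 * c m * t m) - (\<Sum>m\<in>A. (c m)\<^sup>2)) \<le> a * (\<Sum>m\<in>A. (t m)\<^sup>2)"
proof (intro mult_left_mono assms)
  have "2 * c m * t m - (c m)\<^sup>2 \<le> (t m)\<^sup>2" for m
    using zero_le_power2[of "t m - c m"] by (simp add: power2_diff algebra_simps)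
  then show "(\<Sum>m\<in>A. 2 * c m * t m) - (\<Sum>m\<in>A. (c m)\<^sup>2) \<le> (\<Sum>m\<in>A. (t m)\<^sup>2)"
    unfolding sum_subtractf[symmetric] by (intro sum_mono)
qed

lemma partition_sum_pos:
  assumes "\<rho> > 0" shows "partition_sum \<rho> a n > 0"
  unfolding partition_sum_def using assms by (intro sum_pos) auto

text \<open>
  The energy is linearised at the profile \<open>tail_sum p n\<close> itself, so that nothing is lost when the
  linearised energy is evaluated at \<open>p\<close>. The entropies enter only through the conjugate inequality,
  hence \<open>r i\<close> may be any number satisfying it. This form passes to averages: in the application
  \<open>p i\<close> and \<open>r i\<close> are the averages over a block of a density and of \<open>rate_fun\<close> of that density.
\<close>

lemma ln_partition_sum_ge:
  assumes "\<rho> > 0" "a \<ge> 0" and r: "\<And>i h. i < n \<Longrightarrow> p i * h - r i \<le> ln (1 + exp h)"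
  shows "(\<Sum>i<n. p i) * ln \<rho> + a * (\<Sum>m<n. (tail_sum p n m)\<^sup>2) - (\<Sum>i<n. r i) \<le> ln (partition_sum \<rho> a n)"
proof -
  define c where "c = tail_sum p n"
  define h where "h i = ln \<rho> + 2 * a * (\<Sum>m<i. c m)" for i
  have "(\<Prod>i<n. 1 + exp (h i)) * exp (- a * (\<Sum>m<n. (c m)\<^sup>2))
     = (\<Sum>S\<in>Pow {..<n}. \<rho> ^ card S * exp (a * (\<Sum>m<n. 2 * c m * tail_sum (indicator S) n m)))
         * exp (- a * (\<Sum>m<n. (c m)\<^sup>2))"
    unfolding linearised_partition_sum[OF assms(1)] h_def ..
  also have "\<dots> \<le> partition_sum \<rho> a n"
    unfolding partition_sum_def sum_distrib_right
  proof (rule sum_mono)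
    fix S
    have "a * ((\<Sum>m<n. 2 * c m * tail_sum (indicator S) n m) - (\<Sum>m<n. (c m)\<^sup>2))
        \<le> a * (\<Sum>m<n. (tail_sum (indicator S) n m)\<^sup>2)"
      by (rule square_sum_ge_linearisation) fact
    then show "\<rho> ^ card S * exp (a * (\<Sum>m<n. 2 * c m * tail_sum (indicator S) n m))
         * exp (- a * (\<Sum>m<n. (c m)\<^sup>2)) \<le> \<rho> ^ card S * exp (a * (\<Sum>m<n. (tail_sum (indicator S) n m)\<^sup>2))"
      using assms(1) by (simp add: mult.assoc exp_add[symmetric] right_diff_distrib)
  qed
  finally have "ln ((\<Prod>i<n. 1 + exp (h i)) * exp (- a * (\<Sum>m<n. (c m)\<^sup>2))) \<le> ln (partition_sum \<rho> a n)"
    by (intro ln_mono mult_pos_pos prod_pos) (auto simp: add_pos_pos)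
  moreover have "ln ((\<Prod>i<n. 1 + exp (h i)) * exp (- a * (\<Sum>m<n. (c m)\<^sup>2)))
      = (\<Sum>i<n. ln (1 + exp (h i))) - a * (\<Sum>m<n. (c m)\<^sup>2)"
  proof -
    have "0 < (\<Prod>i<n. 1 + exp (h i))" by (intro prod_pos) (auto simp: add_pos_pos)
    moreover have "ln (\<Prod>i<n. 1 + exp (h i)) = (\<Sum>i<n. ln (1 + exp (h i)))"
      by (rule ln_prod[OF finite_lessThan]) (metis add_pos_pos exp_gt_zero less_irrefl zero_less_one)
    ultimately show ?thesis by (simp add: ln_mult_pos)
  qed
  moreover have "(\<Sum>i<n. p i * h i - r i) \<le> (\<Sum>i<n. ln (1 + exp (h i)))"
    using r by (intro sum_mono) auto
  moreover have "(\<Sum>i<n. p i * h i) = (\<Sum>i<n. p i) * ln \<rho> + 2 * a * (\<Sum>m<n. (c m)\<^sup>2)"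
  proof -
    have "(\<Sum>i<n. p i * (\<Sum>m<i. c m)) = (\<Sum>m<n. (c m)\<^sup>2)"
      unfolding tail_sum_adjoint[symmetric] c_def by (simp add: power2_eq_square)
    then show ?thesis
      unfolding h_def by (simp add: distrib_left sum.distrib sum_distrib_right sum_distrib_left[symmetric]
        mult.left_commute[of _ "2 * a"])
  qed
  ultimately show ?thesis
    unfolding c_def[symmetric] by (simp add: sum_subtractf)
qed

text \<open>
  The counting profile of a set is determined up to an error of at most \<open>b\<close> by its values at the
  multiples of \<open>b\<close>, and these take at most \<open>(n + 1) ^ (n div b + 1)\<close> values. For each of them the
  energy is linearised at the corresponding step profile \<open>c f\<close>, at the price of \<open>b\<^sup>2\<close> for each of the
  \<open>n\<close> terms. The linearised sum is then evaluated exactly: the logistic parameters \<open>p\<close> attain equality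
  in the conjugate inequality, and the tangent inequality bounds the result by the discrete functional
  at \<open>p\<close>. A subexponential number of terms does not matter on the exponential scale.
\<close>

lemma ln_partition_sum_le:
  assumes "\<rho> > 0" "a \<ge> 0" "b \<ge> 1"
    and B: "\<And>p. (\<And>i. 0 \<le> p i \<and> p i \<le> 1) \<Longrightarrow> discrete_functional \<rho> a n p \<le> B"
  shows "ln (partition_sum \<rho> a n) \<le> B + a * real n * (real b)\<^sup>2 + real (n div b + 1) * ln (real n + 1)"
proof -
  \<comment> \<open>The index set of the step profiles: values of the counting profile at the multiples of \<open>b\<close>.\<close>
  define F where "F = PiE {..n div b} (\<lambda>_. {..n})"
  define c where "c f m = real (f (m div b))" for f :: "nat \<Rightarrow> nat" and m
  define k where "k S = tail_sum (indicator S) n" for S :: "nat set"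
  define L where "L S f = \<rho> ^ card S * exp (a * (\<Sum>m<n. 2 * c f m * k S m)) * exp (- a * (\<Sum>m<n. (c f m)\<^sup>2))" for S f
  have finF: "finite F" unfolding F_def by (intro finite_PiE) auto
  have cardF: "card F = (n + 1) ^ (n div b + 1)" unfolding F_def by (simp add: card_PiE)
  have each: "\<rho> ^ card S * exp (a * (\<Sum>m<n. (k S m)\<^sup>2)) \<le> exp (a * real n * (real b)\<^sup>2) * (\<Sum>f\<in>F. L S f)"
    if "S \<in> Pow {..<n}" for S
  proof -
    have kcard: "k S m = real (card (S \<inter> {m<..<n}))" for m
      unfolding k_def by (rule tail_sum_indicator_card)
    define f where "f = restrict (\<lambda>j. card (S \<inter> {b * j<..<n})) {..n div b}"
    have "card (S \<inter> {b * j<..<n}) \<le> n" for j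
    proof -
      have "card (S \<inter> {b * j<..<n}) \<le> card {..<n}" by (rule card_mono) auto
      then show ?thesis by simp
    qed
    then have "f \<in> F" unfolding f_def F_def by auto
    have diff: "(k S m - c f m)\<^sup>2 \<le> (real b)\<^sup>2" if "m < n" for m
    proof -
      have "m div b \<le> n div b" using that by (simp add: div_le_mono)
      then have cf: "c f m = real (card (S \<inter> {b * (m div b)<..<n}))" unfolding c_def f_def by simp
      have "b * (m div b) < x" if "m < x" for x
        using that times_div_less_eq_dividend[of b m] by linarith
      then have 1: "card (S \<inter> {m<..<n}) \<le> card (S \<inter> {b * (m div b)<..<n})"
        by (intro card_mono) auto
      have "card (S \<inter> {b * (m div b)<..<n}) \<le> card (S \<inter> {m<..<n} \<union> {b * (m div b)<..m})"
        by (rule card_mono) auto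
      also have "\<dots> \<le> card (S \<inter> {m<..<n}) + card {b * (m div b)<..m}" by (rule card_Un_le)
      also have "card {b * (m div b)<..m} = m mod b" by (simp add: minus_mult_div_eq_mod)
      also have "m mod b \<le> b" using assms(3) by (simp add: order_less_imp_le)
      finally have 2: "card (S \<inter> {b * (m div b)<..<n}) \<le> card (S \<inter> {m<..<n}) + b" by simp
      have "\<bar>k S m - c f m\<bar> \<le> \<bar>real b\<bar>" unfolding cf kcard using 1 2 by linarith
      then show ?thesis by (rule power2_mono)
    qed
    \<comment> \<open>The square is expanded around the step profile; the remainder is at most \<open>b\<^sup>2\<close> per term.\<close>
    have "(\<Sum>m<n. (k S m)\<^sup>2) = (\<Sum>m<n. 2 * c f m * k S m) - (\<Sum>m<n. (c f m)\<^sup>2) + (\<Sum>m<n. (k S m - c f m)\<^sup>2)"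
      by (simp add: power2_diff sum.distrib sum_subtractf algebra_simps)
    also have "(\<Sum>m<n. (k S m - c f m)\<^sup>2) \<le> real n * (real b)\<^sup>2"
      using sum_bounded_above[of "{..<n}" "\<lambda>m. (k S m - c f m)\<^sup>2" "(real b)\<^sup>2"] diff by simp
    finally have "a * (\<Sum>m<n. (k S m)\<^sup>2)
        \<le> a * ((\<Sum>m<n. 2 * c f m * k S m) - (\<Sum>m<n. (c f m)\<^sup>2) + real n * (real b)\<^sup>2)"
      using assms(2) by (simp add: mult_left_mono)
    then have "\<rho> ^ card S * exp (a * (\<Sum>m<n. (k S m)\<^sup>2)) \<le> exp (a * real n * (real b)\<^sup>2) * L S f"
      using assms(1) unfolding L_def
      by (simp add: exp_add[symmetric] mult.left_commute[of "exp _" "\<rho> ^ card S"] algebra_simps)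
    also have "L S f \<le> (\<Sum>f\<in>F. L S f)"
      using \<open>f \<in> F\<close> finF assms(1) by (intro member_le_sum) (auto simp: L_def)
    finally show ?thesis by (simp add: mult_left_mono)
  qed
  have sumL: "(\<Sum>S\<in>Pow {..<n}. L S f) \<le> exp B" for f
  proof -
    define h where "h i = ln \<rho> + 2 * a * (\<Sum>m<i. c f m)" for i
    have "\<exists>x. 0 \<le> x \<and> x \<le> 1 \<and> ln (1 + exp (h i)) = x * h i - rate_fun x" for i
      by (rule rate_fun_dual_eq[of "h i"]) blast
    then obtain p where p: "\<And>i. 0 \<le> p i \<and> p i \<le> 1" "\<And>i. ln (1 + exp (h i)) = p i * h i - rate_fun (p i)"
      by metis
    have "(\<Sum>S\<in>Pow {..<n}. L S f) = (\<Prod>i<n. 1 + exp (h i)) * exp (- a * (\<Sum>m<n. (c f m)\<^sup>2))"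
      unfolding L_def k_def sum_distrib_right[symmetric] linearised_partition_sum[OF assms(1)] h_def ..
    also have "(\<Prod>i<n. 1 + exp (h i)) = exp (\<Sum>i<n. ln (1 + exp (h i)))"
      unfolding exp_sum[OF finite_lessThan] by (intro prod.cong[OF refl]) (simp add: add_pos_pos)
    also have "(\<Sum>i<n. ln (1 + exp (h i)))
        = (\<Sum>i<n. p i) * ln \<rho> + a * (\<Sum>m<n. 2 * c f m * tail_sum p n m) - (\<Sum>i<n. rate_fun (p i))"
    proof -
      have "(\<Sum>i<n. p i * (2 * a * (\<Sum>m<i. c f m))) = 2 * a * (\<Sum>i<n. p i * (\<Sum>m<i. c f m))"
        by (simp add: sum_distrib_left mult_ac)
      also have "\<dots> = a * (\<Sum>m<n. 2 * c f m * tail_sum p n m)"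
        unfolding tail_sum_adjoint[symmetric] by (simp add: sum_distrib_left mult_ac)
      finally show ?thesis
        unfolding p(2) unfolding h_def
        by (simp only: distrib_left sum.distrib sum_subtractf sum_distrib_right)
    qed
    also have "exp \<dots> * exp (- a * (\<Sum>m<n. (c f m)\<^sup>2)) \<le> exp B"
    proof -
      have "a * ((\<Sum>m<n. 2 * c f m * tail_sum p n m) - (\<Sum>m<n. (c f m)\<^sup>2))
          \<le> a * (\<Sum>m<n. (tail_sum p n m)\<^sup>2)"
        by (rule square_sum_ge_linearisation) fact
      moreover have "discrete_functional \<rho> a n p \<le> B" using p(1) by (rule B)
      ultimately show ?thesis
        unfolding discrete_functional_def exp_add[symmetric] by (simp add: right_diff_distrib)
    qed
    finally show ?thesis .
  qed
  have "partition_sum \<rho> a n \<le> (\<Sum>S\<in>Pow {..<n}. exp (a * real n * (real b)\<^sup>2) * (\<Sum>f\<in>F. L S f))"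
    unfolding partition_sum_def k_def[symmetric] by (intro sum_mono each)
  also have "\<dots> = exp (a * real n * (real b)\<^sup>2) * (\<Sum>f\<in>F. \<Sum>S\<in>Pow {..<n}. L S f)"
    unfolding sum_distrib_left[symmetric] by (subst sum.swap) simp
  also have "\<dots> \<le> exp (a * real n * (real b)\<^sup>2) * (\<Sum>f\<in>F. exp B)"
    by (intro mult_left_mono sum_mono sumL) auto
  also have "\<dots> = exp (a * real n * (real b)\<^sup>2) * (real n + 1) ^ (n div b + 1) * exp B"
    unfolding cardF sum_constant by (simp add: algebra_simps)
  also have "(real n + 1) ^ (n div b + 1) = exp (real (n div b + 1) * ln (real n + 1))"
    by (simp only: exp_of_nat_mult exp_ln of_nat_0_le_iff add_nonneg_pos zero_less_one)
  finally have "partition_sum \<rho> a n \<le> exp (B + a * real n * (real b)\<^sup>2 + real (n div b + 1) * ln (real n + 1))"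
    by (simp only: exp_add[symmetric] add_ac)
  then show ?thesis
    using partition_sum_pos[OF assms(1)] by (metis exp_gt_zero ln_exp ln_le_cancel_iff)
qed

section \<open>Moments of the growth process\<close>

text \<open>
Completing the square: an exponential tilt shifts the mean of a Gaussian.
\<close>

lemma normal_density_times_exp:
  assumes "s > 0"
  shows "normal_density 0 s x * exp (c * x) = exp (c\<^sup>2 * s\<^sup>2 / 2) * normal_density (c * s\<^sup>2) s x"
proof -
  have "- (x - 0)\<^sup>2 / (2 * s\<^sup>2) + c * x = c\<^sup>2 * s\<^sup>2 / 2 + - (x - c * s\<^sup>2)\<^sup>2 / (2 * s\<^sup>2)"
    using assms by (simp add: field_simps power2_eq_square)
  then show ?thesis
    unfolding normal_density_def by (simp add: exp_add[symmetric] mult.left_commute[of "exp _"])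
qed

lemma normal_exp_moment:
  fixes X :: "'a \<Rightarrow> real"
  assumes X: "distributed M lborel X (normal_density 0 s)" and "s > 0"
  shows "integrable M (\<lambda>\<omega>. exp (c * X \<omega>))"
    and "(\<integral>\<omega>. exp (c * X \<omega>) \<partial>M) = exp (c\<^sup>2 * s\<^sup>2 / 2)"
proof -
  have "integrable lborel (\<lambda>x. normal_density 0 s x * exp (c * x))"
    unfolding normal_density_times_exp[OF \<open>s > 0\<close>] using \<open>s > 0\<close> by simp
  then show "integrable M (\<lambda>\<omega>. exp (c * X \<omega>))"
    using distributed_integrable[OF X, of "\<lambda>x. exp (c * x)"] \<open>s > 0\<close> by simp
  have "(\<integral>\<omega>. exp (c * X \<omega>) \<partial>M) = (\<integral>x. normal_density 0 s x * exp (c * x) \<partial>lborel)"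
    using distributed_integral[OF X, of "\<lambda>x. exp (c * x)"] \<open>s > 0\<close> by simp
  also have "\<dots> = exp (c\<^sup>2 * s\<^sup>2 / 2)"
    unfolding normal_density_times_exp[OF \<open>s > 0\<close>] using \<open>s > 0\<close> by simp
  finally show "(\<integral>\<omega>. exp (c * X \<omega>) \<partial>M) = exp (c\<^sup>2 * s\<^sup>2 / 2)" .
qed

lemma growth_process_prod:
  "growth_process \<rho> x0 \<sigma> \<tau> W n \<omega> = x0 * (\<Prod>i<n. growth_factor \<rho> \<sigma> \<tau> W i \<omega>)"
  by (induction n) (simp_all add: mult_ac)

lemma standard_brownian_motionD:
  assumes "standard_brownian_motion M W"
  shows "prob_space M" "t \<ge> 0 \<Longrightarrow> W t \<in> borel_measurable M" "AE \<omega> in M. W 0 \<omega> = 0"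
    "0 \<le> s \<Longrightarrow> s < t \<Longrightarrow>
       distributed M lborel (\<lambda>\<omega>. W t \<omega> - W s \<omega>) (normal_density 0 (sqrt (t - s)))"
    "0 \<le> u 0 \<Longrightarrow> (\<And>i. i < n \<Longrightarrow> u i \<le> u (Suc i)) \<Longrightarrow>
       prob_space.indep_vars M (\<lambda>_. borel) (\<lambda>i \<omega>. W (u (Suc i)) \<omega> - W (u i) \<omega>) {..<n}"
  using assms unfolding standard_brownian_motion_def by blast+

text \<open>
  Summation by parts turns \<open>\<Sum>i. p i * W (i \<tau>)\<close> into a combination of independent increments in
  which the increment after time \<open>m \<tau>\<close> has weight \<open>tail_sum p n m\<close>. This is where the squares of the
  tail sums come from.
\<close>

lemma brownian_exp_moment:
  fixes W :: "real \<Rightarrow> 'a \<Rightarrow> real"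
  assumes W: "standard_brownian_motion M W" and "\<tau> > 0"
  shows "integrable M (\<lambda>\<omega>. exp (\<sigma> * (\<Sum>i<n. p i * W (real i * \<tau>) \<omega>)))"
    and "(\<integral>\<omega>. exp (\<sigma> * (\<Sum>i<n. p i * W (real i * \<tau>) \<omega>)) \<partial>M)
       = exp (\<sigma>\<^sup>2 * \<tau> / 2 * (\<Sum>m<n. (tail_sum p n m)\<^sup>2))"
proof -
  interpret prob_space M using standard_brownian_motionD(1)[OF W] .
  define D where "D m \<omega> = W (real (Suc m) * \<tau>) \<omega> - W (real m * \<tau>) \<omega>" for m \<omega>
  define Y where "Y m \<omega> = exp (\<sigma> * tail_sum p n m * D m \<omega>)" for m \<omega>
  have meas: "W (real i * \<tau>) \<in> borel_measurable M" for i
    using \<open>\<tau> > 0\<close> by (intro standard_brownian_motionD(2)[OF W]) simp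
  have dist: "distributed M lborel (D m) (normal_density 0 (sqrt \<tau>))" for m
    using standard_brownian_motionD(4)[OF W, of "real m * \<tau>" "real (Suc m) * \<tau>"] \<open>\<tau> > 0\<close>
    unfolding D_def by (simp add: algebra_simps)
  have indD: "indep_vars (\<lambda>_. borel) D {..<n}"
    using standard_brownian_motionD(5)[OF W, of "\<lambda>i. real i * \<tau>" n] \<open>\<tau> > 0\<close>
    unfolding D_def by simp
  have indY: "indep_vars (\<lambda>_. borel) Y {..<n}"
    using indep_vars_compose2[OF indD, of "\<lambda>m x. exp (\<sigma> * tail_sum p n m * x)" "\<lambda>_. borel"]
    unfolding Y_def by simp
  have Y: "integrable M (Y m)" "(\<integral>\<omega>. Y m \<omega> \<partial>M) = exp ((\<sigma> * tail_sum p n m)\<^sup>2 * \<tau> / 2)" for m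
    using normal_exp_moment[OF dist, of "\<sigma> * tail_sum p n m" m] \<open>\<tau> > 0\<close> unfolding Y_def by simp_all
  have W_sum: "AE \<omega> in M. exp (\<sigma> * (\<Sum>i<n. p i * W (real i * \<tau>) \<omega>)) = (\<Prod>m<n. Y m \<omega>)"
    using standard_brownian_motionD(3)[OF W]
  proof eventually_elim
    case (elim \<omega>)
    have "W (real i * \<tau>) \<omega> = (\<Sum>m<i. D m \<omega>)" for i
      by (induction i) (simp_all add: elim D_def)
    then have "(\<Sum>i<n. p i * W (real i * \<tau>) \<omega>) = (\<Sum>m<n. D m \<omega> * tail_sum p n m)"
      by (simp add: tail_sum_adjoint)
    then show ?case by (simp add: Y_def exp_sum sum_distrib_left mult_ac)
  qed
  have int: "integrable M (\<lambda>\<omega>. \<Prod>m<n. Y m \<omega>)"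
    by (rule indep_vars_integrable) (use indY Y in auto)
  have m1: "(\<lambda>\<omega>. exp (\<sigma> * (\<Sum>i<n. p i * W (real i * \<tau>) \<omega>))) \<in> borel_measurable M"
    using meas by measurable
  show "integrable M (\<lambda>\<omega>. exp (\<sigma> * (\<Sum>i<n. p i * W (real i * \<tau>) \<omega>)))"
    using integrable_cong_AE[OF m1 borel_measurable_integrable[OF int] W_sum] int by simp
  have "(\<integral>\<omega>. exp (\<sigma> * (\<Sum>i<n. p i * W (real i * \<tau>) \<omega>)) \<partial>M) = (\<integral>\<omega>. (\<Prod>m<n. Y m \<omega>) \<partial>M)"
    by (rule integral_cong_AE[OF m1 borel_measurable_integrable[OF int] W_sum])
  also have "\<dots> = (\<Prod>m<n. exp ((\<sigma> * tail_sum p n m)\<^sup>2 * \<tau> / 2))"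
    using indep_vars_lebesgue_integral[of "{..<n}" Y] indY Y by simp
  also have "\<dots> = exp (\<sigma>\<^sup>2 * \<tau> / 2 * (\<Sum>m<n. (tail_sum p n m)\<^sup>2))"
    by (simp add: exp_sum[symmetric] sum_distrib_left power_mult_distrib mult_ac)
  finally show "(\<integral>\<omega>. exp (\<sigma> * (\<Sum>i<n. p i * W (real i * \<tau>) \<omega>)) \<partial>M)
       = exp (\<sigma>\<^sup>2 * \<tau> / 2 * (\<Sum>m<n. (tail_sum p n m)\<^sup>2))" .
qed

text \<open>
  The product of the growth factors is expanded into a sum over the sets \<open>S\<close> of indices for which the
  exponential is selected. The deterministic drift contributes the sum of the elements of \<open>S\<close>, which
  is also a sum of tail counts and removes the diagonal terms of the squares.
\<close>

lemma growth_process_moment: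
  fixes W :: "real \<Rightarrow> 'a \<Rightarrow> real"
  assumes W: "standard_brownian_motion M W" and "\<tau> > 0"
  shows "integrable M (growth_process \<rho> x0 \<sigma> \<tau> W n)"
    and "(\<integral>\<omega>. growth_process \<rho> x0 \<sigma> \<tau> W n \<omega> \<partial>M) = x0 * (\<Sum>S\<in>Pow {..<n}. \<rho> ^ card S *
       exp (\<sigma>\<^sup>2 * \<tau> / 2 * (\<Sum>m<n. (tail_sum (indicator S) n m)\<^sup>2 - tail_sum (indicator S) n m)))"
proof -
  define c where "c S = \<rho> ^ card S * exp (- (\<sigma>\<^sup>2 * \<tau> / 2 * (\<Sum>m<n. tail_sum (indicator S) n m)))" for S
  define Z where "Z S \<omega> = exp (\<sigma> * (\<Sum>i<n. indicator S i * W (real i * \<tau>) \<omega>))" for S \<omega>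
  have expand: "growth_process \<rho> x0 \<sigma> \<tau> W n \<omega> = x0 * (\<Sum>S\<in>Pow {..<n}. c S * Z S \<omega>)" for \<omega>
  proof -
    have "(\<Prod>i<n. growth_factor \<rho> \<sigma> \<tau> W i \<omega>)
        = (\<Sum>S\<in>Pow {..<n}. \<Prod>i\<in>S. \<rho> * exp (\<sigma> * W (real i * \<tau>) \<omega> - \<sigma>\<^sup>2 / 2 * (real i * \<tau>)))"
      unfolding growth_factor_def
      by (subst add.commute, subst prod_add) simp_all
    also have "\<dots> = (\<Sum>S\<in>Pow {..<n}. c S * Z S \<omega>)"
    proof (rule sum.cong[OF refl])
      fix S assume "S \<in> Pow {..<n}"
      then have S: "S \<subseteq> {..<n}" "finite S" using finite_subset by auto
      have restr: "(\<Sum>i<n. indicator S i * f i) = (\<Sum>i\<in>S. f i)" for f :: "nat \<Rightarrow> real"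
        using S by (intro sum.mono_neutral_cong_right) auto
      have "(\<Sum>m<n. tail_sum (indicator S) n m) = (\<Sum>i\<in>S. real i)"
        using tail_sum_adjoint[of "\<lambda>_. 1" "indicator S" n] restr[of real] by simp
      then show "(\<Prod>i\<in>S. \<rho> * exp (\<sigma> * W (real i * \<tau>) \<omega> - \<sigma>\<^sup>2 / 2 * (real i * \<tau>))) = c S * Z S \<omega>"
        unfolding c_def Z_def restr using S
        by (simp add: prod.distrib exp_sum[symmetric] mult.assoc exp_add[symmetric] sum_subtractf
          sum_distrib_left sum_distrib_right mult_ac)
    qed
    finally show ?thesis unfolding growth_process_prod by simp
  qed
  have Z: "integrable M (Z S)"
    "(\<integral>\<omega>. Z S \<omega> \<partial>M) = exp (\<sigma>\<^sup>2 * \<tau> / 2 * (\<Sum>m<n. (tail_sum (indicator S) n m)\<^sup>2))" for S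
    unfolding Z_def by (rule brownian_exp_moment[OF assms])+
  show "integrable M (growth_process \<rho> x0 \<sigma> \<tau> W n)"
    unfolding expand using Z(1) by (intro integrable_mult_right integrable_sum) auto
  have "(\<integral>\<omega>. growth_process \<rho> x0 \<sigma> \<tau> W n \<omega> \<partial>M) = x0 * (\<Sum>S\<in>Pow {..<n}. c S * (\<integral>\<omega>. Z S \<omega> \<partial>M))"
    unfolding expand using Z(1) by simp
  also have "(\<Sum>S\<in>Pow {..<n}. c S * (\<integral>\<omega>. Z S \<omega> \<partial>M)) = (\<Sum>S\<in>Pow {..<n}. \<rho> ^ card S *
       exp (\<sigma>\<^sup>2 * \<tau> / 2 * (\<Sum>m<n. (tail_sum (indicator S) n m)\<^sup>2 - tail_sum (indicator S) n m)))"
    unfolding Z(2) c_def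
    by (intro sum.cong[OF refl]) (simp add: mult.assoc exp_add[symmetric] sum_subtractf right_diff_distrib)
  finally show "(\<integral>\<omega>. growth_process \<rho> x0 \<sigma> \<tau> W n \<omega> \<partial>M) = x0 * (\<Sum>S\<in>Pow {..<n}. \<rho> ^ card S *
       exp (\<sigma>\<^sup>2 * \<tau> / 2 * (\<Sum>m<n. (tail_sum (indicator S) n m)\<^sup>2 - tail_sum (indicator S) n m)))" .
qed

text \<open>
  The diagonal terms are negligible: there are at most \<open>n\<^sup>2\<close> of them and each carries \<open>\<beta> / n\<^sup>2\<close>.
\<close>

lemma ln_growth_process_moment_bounds:
  fixes W :: "real \<Rightarrow> 'a \<Rightarrow> real"
  assumes W: "standard_brownian_motion M W" and "\<tau> > 0" "\<rho> > 0" "x0 > 0" "\<beta> > 0" "n \<ge> 1"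
    and \<beta>: "1 / 2 * \<sigma>\<^sup>2 * \<tau> * (real n)\<^sup>2 = \<beta>"
  defines "E \<equiv> (\<integral>\<omega>. growth_process \<rho> x0 \<sigma> \<tau> W n \<omega> \<partial>M)"
  shows "ln (partition_sum \<rho> (\<beta> / (real n)\<^sup>2) n) - \<beta> + ln x0 \<le> ln E"
    and "ln E \<le> ln (partition_sum \<rho> (\<beta> / (real n)\<^sup>2) n) + ln x0"
proof -
  define a where "a = \<beta> / (real n)\<^sup>2"
  have a: "\<sigma>\<^sup>2 * \<tau> / 2 = a" unfolding a_def using \<beta> \<open>n \<ge> 1\<close> by (simp add: field_simps)
  have "a \<ge> 0" unfolding a_def using \<open>\<beta> > 0\<close> by simp
  define Q where "Q = (\<Sum>S\<in>Pow {..<n}. \<rho> ^ card S *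
       exp (a * (\<Sum>m<n. (tail_sum (indicator S) n m)\<^sup>2 - tail_sum (indicator S) n m)))"
  have E: "E = x0 * Q"
    unfolding E_def growth_process_moment(2)[OF assms(1,2)] a Q_def ..
  have "Q > 0" unfolding Q_def using \<open>\<rho> > 0\<close> by (intro sum_pos) auto
  have k: "0 \<le> (\<Sum>m<n. tail_sum (indicator S) n m)" "a * (\<Sum>m<n. tail_sum (indicator S) n m) \<le> \<beta>" for S
  proof -
    show "0 \<le> (\<Sum>m<n. tail_sum (indicator S) n m)"
      unfolding tail_sum_indicator_card by (intro sum_nonneg) simp
    have "card (S \<inter> {m<..<n}) \<le> n" for m
      using card_mono[of "{..<n}" "S \<inter> {m<..<n}"] by (auto simp: subset_iff)
    then have "(\<Sum>m<n. tail_sum (indicator S) n m) \<le> real n * real n"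
      using sum_bounded_above[of "{..<n}" "\<lambda>m. tail_sum (indicator S) n m" "real n"]
      unfolding tail_sum_indicator_card by simp
    then have "a * (\<Sum>m<n. tail_sum (indicator S) n m) \<le> a * (real n * real n)"
      using \<open>a \<ge> 0\<close> by (rule mult_left_mono)
    also have "\<dots> = \<beta>" unfolding a_def using \<open>n \<ge> 1\<close> by (simp add: power2_eq_square)
    finally show "a * (\<Sum>m<n. tail_sum (indicator S) n m) \<le> \<beta>" .
  qed
  have "Q \<le> partition_sum \<rho> a n"
    unfolding Q_def partition_sum_def sum_subtractf
    using k(1) \<open>\<rho> > 0\<close> \<open>a \<ge> 0\<close> by (intro sum_mono mult_left_mono) (auto simp: mult_left_mono)
  moreover have "exp (- \<beta>) * partition_sum \<rho> a n \<le> Q"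
    unfolding Q_def partition_sum_def sum_subtractf sum_distrib_left[of "exp (- \<beta>)"]
  proof (intro sum_mono)
    fix S
    have "exp (- \<beta>) * exp (a * (\<Sum>m<n. (tail_sum (indicator S) n m)\<^sup>2))
        \<le> exp (a * ((\<Sum>m<n. (tail_sum (indicator S) n m)\<^sup>2) - (\<Sum>m<n. tail_sum (indicator S) n m)))"
      unfolding exp_add[symmetric] using k(2)[of S] by (simp add: right_diff_distrib)
    then have "\<rho> ^ card S * (exp (- \<beta>) * exp (a * (\<Sum>m<n. (tail_sum (indicator S) n m)\<^sup>2)))
        \<le> \<rho> ^ card S * exp (a * ((\<Sum>m<n. (tail_sum (indicator S) n m)\<^sup>2) - (\<Sum>m<n. tail_sum (indicator S) n m)))"
      using \<open>\<rho> > 0\<close> by (intro mult_left_mono) auto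
    then show "exp (- \<beta>) * (\<rho> ^ card S * exp (a * (\<Sum>m<n. (tail_sum (indicator S) n m)\<^sup>2)))
        \<le> \<rho> ^ card S * exp (a * ((\<Sum>m<n. (tail_sum (indicator S) n m)\<^sup>2) - (\<Sum>m<n. tail_sum (indicator S) n m)))"
      by (simp add: mult.left_commute)
  qed
  then have "ln (exp (- \<beta>) * partition_sum \<rho> a n) \<le> ln Q"
    using partition_sum_pos[OF \<open>\<rho> > 0\<close>] by (intro ln_mono) auto
  moreover have "ln (exp (- \<beta>) * partition_sum \<rho> a n) = ln (partition_sum \<rho> a n) - \<beta>"
    using partition_sum_pos[OF \<open>\<rho> > 0\<close>, of a n] by (simp add: ln_mult_pos)
  moreover have "ln E = ln x0 + ln Q" unfolding E using \<open>Q > 0\<close> \<open>x0 > 0\<close> by (simp add: ln_mult_pos)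
  ultimately show "ln (partition_sum \<rho> (\<beta> / (real n)\<^sup>2) n) - \<beta> + ln x0 \<le> ln E"
    and "ln E \<le> ln (partition_sum \<rho> (\<beta> / (real n)\<^sup>2) n) + ln x0"
    using \<open>Q > 0\<close> ln_mono[of Q "partition_sum \<rho> a n"] unfolding a_def by auto
qed

section \<open>Admissible functions and the lower bound\<close>

lemma rate_fun_measurable [measurable]: "rate_fun \<in> borel_measurable borel"
  unfolding rate_fun_def[abs_def] by measurable

lemma rate_fun_abs_le:
  assumes "0 \<le> x" "x \<le> 1" shows "\<bar>rate_fun x\<bar> \<le> ln 2"
proof -
  have "x * ln x \<le> 0" if "0 \<le> x" "x \<le> 1" for x :: real
    using that by (cases "x = 0") (auto intro!: mult_nonneg_nonpos)
  from this[of x] this[of "1 - x"] have "rate_fun x \<le> 0"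
    unfolding rate_fun_def using assms by simp
  then show ?thesis using rate_fun_dual[OF assms, of 0] by simp
qed

text \<open>
  The function \<open>q\<close> is a version of the derivative with values in \<open>[0, 1]\<close> at every point,
  so that its bounds and those of \<open>rate_fun\<close> along it hold without exceptional points.
\<close>

lemma admissible_derivative:
  assumes "g \<in> admissible"
  obtains q N where "\<And>x. 0 \<le> q x \<and> q x \<le> 1" "negligible N" "\<And>x. x \<in> {0..1} - N \<Longrightarrow> deriv g x = q x"
    "\<And>a b. 0 \<le> a \<Longrightarrow> a \<le> b \<Longrightarrow> b \<le> 1 \<Longrightarrow> (q has_integral (g b - g a)) {a..b}"
proof -
  define N where "N = {x \<in> {0..1}. \<not> (g differentiable (at x) \<and> 0 \<le> deriv g x \<and> deriv g x \<le> 1)}"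
  have ac: "abs_continuous_on_interval 0 1 g"
    and ae: "AE x in lebesgue. x \<in> {0..1} \<longrightarrow> g differentiable (at x) \<and> 0 \<le> deriv g x \<and> deriv g x \<le> 1"
    using assms unfolding admissible_def by auto
  have "{x \<in> space lebesgue. \<not> (x \<in> {0..1} \<longrightarrow>
      g differentiable (at x) \<and> 0 \<le> deriv g x \<and> deriv g x \<le> 1)} = N"
    unfolding N_def by auto
  with ae have N: "negligible N"
    unfolding negligible_iff_null_sets completion.AE_iff_null_sets by simp
  define q where "q x = (if x \<in> {0..1} - N then deriv g x else 0)" for x
  show thesis
  proof (rule that)
    show "0 \<le> q x \<and> q x \<le> 1" for x unfolding q_def N_def by auto
    show "negligible N" by (rule N)
    show "deriv g x = q x" if "x \<in> {0..1} - N" for x using that unfolding q_def by simp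
    show "(q has_integral (g b - g a)) {a..b}" if ab: "0 \<le> a" "a \<le> b" "b \<le> 1" for a b
    proof (rule abs_continuous_has_integral_derivative[OF ab(2) _ N])
      show "abs_continuous_on_interval a b g"
        using abs_continuous_on_interval_subset[OF ac] ab by simp
      fix x assume x: "x \<in> {a..b} - N"
      then have "x \<in> {0..1} - N" using ab by auto
      then have "g differentiable (at x)" "q x = deriv g x" unfolding N_def q_def by auto
      then have "(g has_real_derivative q x) (at x)"
        by (simp add: DERIV_deriv_iff_real_differentiable)
      then show "(g has_real_derivative q x) (at x within {a..b})"
        by (rule has_field_derivative_at_within)
    qed
  qed
qed

lemma admissible_increments:
  assumes "g \<in> admissible" "0 \<le> a" "a \<le> b" "b \<le> 1"
  shows "0 \<le> g b - g a" "g b - g a \<le> b - a"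
proof -
  obtain q where q: "\<And>x. 0 \<le> q x \<and> q x \<le> 1" "(q has_integral (g b - g a)) {a..b}"
    using admissible_derivative[OF assms(1)] assms(2-4) by metis
  show "0 \<le> g b - g a" by (rule has_integral_nonneg[OF q(2)]) (use q(1) in auto)
  have "((\<lambda>x. 1 :: real) has_integral (b - a)) {a..b}"
    using has_integral_const_real[of "1::real" a b] assms by simp
  from has_integral_le[OF q(2) this] show "g b - g a \<le> b - a" using q(1) by auto
qed

lemma admissible_continuous_on:
  assumes "g \<in> admissible" shows "continuous_on {0..1} g"
proof -
  have "\<bar>g x - g y\<bar> \<le> \<bar>x - y\<bar>" if "x \<in> {0..1}" "y \<in> {0..1}" for x y
    using admissible_increments[OF assms, of x y] admissible_increments[OF assms, of y x] that
    by (cases "x \<le> y") auto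
  then have "1-lipschitz_on {0..1} g"
    by (intro lipschitz_onI) (auto simp: dist_real_def)
  then show ?thesis by (rule lipschitz_on_continuous_on)
qed

lemma admissible_entropy_integral:
  assumes q: "\<And>x. 0 \<le> q x \<and> q x \<le> 1" "q integrable_on {0..1}"
    and N: "negligible N" "\<And>x. x \<in> {0..1} - N \<Longrightarrow> deriv g x = q x"
  shows "(\<lambda>x. rate_fun (q x)) integrable_on {0..1}"
    and "(LINT x:{0..1}|lebesgue. rate_fun (deriv g x)) = integral {0..1} (\<lambda>x. rate_fun (q x))"
proof -
  have "q \<in> borel_measurable (lebesgue_on {0..1})" by (rule integrable_imp_measurable) fact
  then have "(\<lambda>x. rate_fun (q x)) \<in> borel_measurable (lebesgue_on {0..1})" by measurable
  then have int: "(\<lambda>x. rate_fun (q x)) absolutely_integrable_on {0..1}"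
    using rate_fun_abs_le q(1)
    by (intro measurable_bounded_by_integrable_imp_absolutely_integrable[where g = "\<lambda>_. ln 2"]) auto
  then show "(\<lambda>x. rate_fun (q x)) integrable_on {0..1}"
    by (rule set_lebesgue_integral_eq_integral(1))
  have "(\<lambda>x. rate_fun (deriv g x)) absolutely_integrable_on {0..1}"
    by (rule absolutely_integrable_spike[OF int N(1)]) (simp add: N(2))
  then have "(LINT x:{0..1}|lebesgue. rate_fun (deriv g x)) = integral {0..1} (\<lambda>x. rate_fun (deriv g x))"
    by (rule set_lebesgue_integral_eq_integral(2))
  also have "\<dots> = integral {0..1} (\<lambda>x. rate_fun (q x))"
    by (rule integral_spike[OF N(1)]) (simp add: N(2))
  finally show "(LINT x:{0..1}|lebesgue. rate_fun (deriv g x)) = integral {0..1} (\<lambda>x. rate_fun (q x))" .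
qed

lemma admissible_density:
  assumes "g \<in> admissible"
  obtains q N where "\<And>x. 0 \<le> q x \<and> q x \<le> 1" "negligible N" "\<And>x. x \<in> {0..1} - N \<Longrightarrow> deriv g x = q x"
    "\<And>a b. 0 \<le> a \<Longrightarrow> a \<le> b \<Longrightarrow> b \<le> 1 \<Longrightarrow> (q has_integral (g b - g a)) {a..b}"
    "(\<lambda>x. rate_fun (q x)) integrable_on {0..1}"
    "(LINT x:{0..1}|lebesgue. rate_fun (deriv g x)) = integral {0..1} (\<lambda>x. rate_fun (q x))"
proof -
  obtain q N where q: "\<And>x. 0 \<le> q x \<and> q x \<le> 1" and N: "negligible N" "\<And>x. x \<in> {0..1} - N \<Longrightarrow> deriv g x = q x"
    and qint: "\<And>a b. 0 \<le> a \<Longrightarrow> a \<le> b \<Longrightarrow> b \<le> 1 \<Longrightarrow> (q has_integral (g b - g a)) {a..b}"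
    using admissible_derivative[OF assms] by metis
  have "q integrable_on {0..1}" using qint[of 0 1] by (auto simp: integrable_on_def)
  note int = this
  have "(\<lambda>x. rate_fun (q x)) integrable_on {0..1}"
    by (rule admissible_entropy_integral(1)[of q N g]) (use q N int in blast)+
  moreover have "(LINT x:{0..1}|lebesgue. rate_fun (deriv g x)) = integral {0..1} (\<lambda>x. rate_fun (q x))"
    by (rule admissible_entropy_integral(2)[of q N g]) (use q N int in blast)+
  ultimately show thesis using that q N qint by blast
qed

lemma integral_unit_interval_blocks:
  fixes f :: "real \<Rightarrow> real"
  assumes "f integrable_on {0..1}" "n \<ge> 1"
  shows "integral {0..1} f = (\<Sum>i<n. integral {real i / real n..real (Suc i) / real n} f)"
proof -
  have "integral {0..real k / real n} f = (\<Sum>i<k. integral {real i / real n..real (Suc i) / real n} f)"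
    if "k \<le> n" for k
    using that
  proof (induction k)
    case (Suc k)
    have "real k / real n \<le> real (Suc k) / real n" "real (Suc k) / real n \<le> 1"
      using Suc.prems by (simp_all add: divide_right_mono)
    moreover from this have "f integrable_on {0..real (Suc k) / real n}"
      by (intro integrable_on_subinterval[OF assms(1)]) auto
    ultimately have "integral {0..real k / real n} f + integral {real k / real n..real (Suc k) / real n} f
        = integral {0..real (Suc k) / real n} f"
      by (intro Henstock_Kurzweil_Integration.integral_combine) auto
    then show ?case using Suc by simp
  qed simp
  from this[of n] show ?thesis using \<open>n \<ge> 1\<close> by simp
qed

lemma grid_point_bounds:
  assumes "i < n"
  shows "0 \<le> real i / real n" "real i / real n \<le> real (Suc i) / real n" "real (Suc i) / real n \<le> 1"
    "real (Suc i) / real n - real i / real n = 1 / real n"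
  using assms by (simp_all add: field_simps)

text \<open>
  The integrand \<open>(g 1 - g x)\<^sup>2\<close> is decreasing and varies by at most \<open>1\<close>. Hence its right Riemann sum
  with \<open>n\<close> cells is a lower sum, and the upper and the lower sum differ by at most \<open>1 / n\<close>.
\<close>

lemma admissible_riemann_bounds:
  assumes g: "g \<in> admissible" and "n \<ge> 1"
  defines "R \<equiv> (\<Sum>m<n. (g 1 - g (real (Suc m) / real n))\<^sup>2)"
    and "J \<equiv> real n * (LINT x:{0..1}|lebesgue. (g 1 - g x)\<^sup>2)"
  shows "R \<le> J" "J \<le> R + 1"
proof -
  define f where "f x = (g 1 - g x)\<^sup>2" for x
  have cont: "continuous_on {0..1} f"
    unfolding f_def by (intro continuous_intros admissible_continuous_on g)
  then have fint: "f integrable_on {0..1}" by (rule integrable_continuous_real)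
  have "f absolutely_integrable_on {0..1}"
    by (rule nonnegative_absolutely_integrable_1[OF fint]) (simp add: f_def)
  then have "J = real n * integral {0..1} f"
    unfolding J_def f_def by (subst set_lebesgue_integral_eq_integral(2)) auto
  also have "\<dots> = (\<Sum>i<n. real n * integral {real i / real n..real (Suc i) / real n} f)"
    by (simp add: integral_unit_interval_blocks[OF fint \<open>n \<ge> 1\<close>] sum_distrib_left)
  finally have J: "J = (\<Sum>i<n. real n * integral {real i / real n..real (Suc i) / real n} f)" .
  have anti: "f y \<le> f x" if "0 \<le> x" "x \<le> y" "y \<le> 1" for x y
    unfolding f_def using admissible_increments(1)[OF g, of x y] admissible_increments(1)[OF g, of y 1] that
    by (intro power_mono) auto
  have block: "f (real (Suc i) / real n) \<le> real n * integral {real i / real n..real (Suc i) / real n} f"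
    "real n * integral {real i / real n..real (Suc i) / real n} f \<le> f (real i / real n)" if "i < n" for i
  proof -
    note gp = grid_point_bounds[OF that]
    let ?I = "{real i / real n..real (Suc i) / real n}"
    have int: "f integrable_on ?I" using gp by (intro integrable_on_subinterval[OF fint]) auto
    have const: "real n * integral ?I (\<lambda>_. c) = c" for c :: real
      using gp(2,4) \<open>n \<ge> 1\<close> by simp
    have nonneg: "0 \<le> x" if "x \<in> ?I" for x using that order_trans[OF gp(1), of x] by simp
    have "integral ?I (\<lambda>_. f (real (Suc i) / real n)) \<le> integral ?I f"
      using gp nonneg by (intro integral_le int anti) auto
    then have "real n * integral ?I (\<lambda>_. f (real (Suc i) / real n)) \<le> real n * integral ?I f"
      by (rule mult_left_mono) simp
    then show "f (real (Suc i) / real n) \<le> real n * integral ?I f" unfolding const .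
    have "integral ?I f \<le> integral ?I (\<lambda>_. f (real i / real n))"
      using gp by (intro integral_le int anti) auto
    then have "real n * integral ?I f \<le> real n * integral ?I (\<lambda>_. f (real i / real n))"
      by (rule mult_left_mono) simp
    then show "real n * integral ?I f \<le> f (real i / real n)" unfolding const .
  qed
  show "R \<le> J" unfolding R_def J f_def[symmetric] by (intro sum_mono block) auto
  have "J \<le> (\<Sum>i<n. f (real i / real n))" unfolding J by (intro sum_mono block) auto
  also have "\<dots> = R + f 0 - f 1"
  proof -
    have "(\<Sum>i<n. f (real (Suc i) / real n) - f (real i / real n)) = f 1 - f 0"
      using sum_lessThan_telescope[of "\<lambda>i. f (real i / real n)" n] \<open>n \<ge> 1\<close> by simp
    then show ?thesis unfolding R_def f_def[symmetric] by (simp add: sum_subtractf)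
  qed
  also have "\<dots> \<le> R + 1"
  proof -
    have "g 0 = 0" "0 \<le> g 1" "g 1 \<le> 1"
      using g admissible_increments[OF g, of 0 1] unfolding admissible_def by auto
    then show ?thesis unfolding f_def by (simp add: power_le_one)
  qed
  finally show "J \<le> R + 1" .
qed

lemma tail_sum_increments:
  fixes u :: "nat \<Rightarrow> real"
  assumes "m < n"
  shows "tail_sum (\<lambda>i. c * (u (Suc i) - u i)) n m = c * (u n - u (Suc m))"
proof -
  have "{m<..<n} = {Suc m..<n}" by auto
  then show ?thesis
    unfolding tail_sum_def sum_distrib_left[symmetric] using sum_Suc_diff'[of "Suc m" n u] assms by simp
qed

text \<open>
  The lower bound, valid for every \<open>n\<close>: the discrete parameters are the averages of the density over
  the blocks, and the conjugate inequality is integrated over each block. The loss \<open>\<beta>\<close> comes from the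
  Riemann sum. The case \<open>n = 1\<close> also shows that the functional is bounded above.
\<close>

lemma growth_functional_le_ln_partition_sum:
  assumes g: "g \<in> admissible" and "n \<ge> 1" "\<rho> > 0" "\<beta> > 0"
  shows "real n * growth_functional \<rho> \<beta> g - \<beta> \<le> ln (partition_sum \<rho> (\<beta> / (real n)\<^sup>2) n)"
proof -
  obtain q N where q: "\<And>x. 0 \<le> q x \<and> q x \<le> 1" and N: "negligible N" "\<And>x. x \<in> {0..1} - N \<Longrightarrow> deriv g x = q x"
    and qint: "\<And>a b. 0 \<le> a \<Longrightarrow> a \<le> b \<Longrightarrow> b \<le> 1 \<Longrightarrow> (q has_integral (g b - g a)) {a..b}"
    and ent: "(\<lambda>x. rate_fun (q x)) integrable_on {0..1}"
      "(LINT x:{0..1}|lebesgue. rate_fun (deriv g x)) = integral {0..1} (\<lambda>x. rate_fun (q x))"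
    by (rule admissible_density[OF g]) blast
  have g0: "g 0 = 0" using g unfolding admissible_def by simp
  define u where "u i = g (real i / real n)" for i
  define p where "p i = real n * (u (Suc i) - u i)" for i
  define r where "r i = real n * integral {real i / real n..real (Suc i) / real n} (\<lambda>x. rate_fun (q x))" for i
  have "(\<Sum>i<n. p i) * ln \<rho> + \<beta> / (real n)\<^sup>2 * (\<Sum>m<n. (tail_sum p n m)\<^sup>2) - (\<Sum>i<n. r i)
      \<le> ln (partition_sum \<rho> (\<beta> / (real n)\<^sup>2) n)"
  proof (rule ln_partition_sum_ge)
    fix i h assume "i < n"
    note gp = grid_point_bounds[OF \<open>i < n\<close>]
    let ?I = "{real i / real n..real (Suc i) / real n}"
    have rint: "(\<lambda>x. rate_fun (q x)) integrable_on ?I"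
      using gp by (intro integrable_on_subinterval[OF ent(1)]) auto
    have "((\<lambda>x. q x * h - rate_fun (q x)) has_integral
        ((u (Suc i) - u i) * h - integral ?I (\<lambda>x. rate_fun (q x)))) ?I"
      unfolding u_def using gp
      by (intro has_integral_diff has_integral_mult_left qint integrable_integral rint)
    moreover have "((\<lambda>x. ln (1 + exp h)) has_integral (1 / real n * ln (1 + exp h))) ?I"
      using has_integral_const_real[of "ln (1 + exp h)" "real i / real n" "real (Suc i) / real n"]
      using gp by simp
    ultimately have "(u (Suc i) - u i) * h - integral ?I (\<lambda>x. rate_fun (q x)) \<le> 1 / real n * ln (1 + exp h)"
      by (rule has_integral_le) (use q rate_fun_dual in blast)
    then have "real n * ((u (Suc i) - u i) * h - integral ?I (\<lambda>x. rate_fun (q x)))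
        \<le> real n * (1 / real n * ln (1 + exp h))"
      by (rule mult_left_mono) simp
    then show "p i * h - r i \<le> ln (1 + exp h)"
      unfolding p_def r_def using \<open>n \<ge> 1\<close> by (simp add: right_diff_distrib left_diff_distrib mult.assoc)
  qed (use assms in auto)
  moreover have "(\<Sum>i<n. p i) = real n * g 1"
    using sum_lessThan_telescope[of u n] \<open>n \<ge> 1\<close> g0
    unfolding p_def sum_distrib_left[symmetric] by (simp add: u_def)
  moreover have "(\<Sum>i<n. r i) = real n * (LINT x:{0..1}|lebesgue. rate_fun (deriv g x))"
    unfolding r_def ent(2) integral_unit_interval_blocks[OF ent(1) \<open>n \<ge> 1\<close>] sum_distrib_left ..
  moreover have "\<beta> / (real n)\<^sup>2 * (\<Sum>m<n. (tail_sum p n m)\<^sup>2)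
      = \<beta> * (\<Sum>m<n. (g 1 - g (real (Suc m) / real n))\<^sup>2)"
  proof -
    have "tail_sum p n m = real n * (g 1 - g (real (Suc m) / real n))" if "m < n" for m
      using tail_sum_increments[OF that, of "real n" u] \<open>n \<ge> 1\<close> unfolding p_def u_def by simp
    then have "(\<Sum>m<n. (tail_sum p n m)\<^sup>2) = (\<Sum>m<n. (real n)\<^sup>2 * (g 1 - g (real (Suc m) / real n))\<^sup>2)"
      by (intro sum.cong[OF refl]) (simp add: power_mult_distrib)
    then show ?thesis using \<open>n \<ge> 1\<close> by (simp add: sum_distrib_left[symmetric])
  qed
  moreover have "\<beta> * (real n * (LINT x:{0..1}|lebesgue. (g 1 - g x)\<^sup>2))
      \<le> \<beta> * ((\<Sum>m<n. (g 1 - g (real (Suc m) / real n))\<^sup>2) + 1)"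
    using admissible_riemann_bounds(2)[OF g \<open>n \<ge> 1\<close>] \<open>\<beta> > 0\<close> by (intro mult_left_mono) auto
  ultimately show ?thesis unfolding growth_functional_def by (simp add: algebra_simps)
qed

section \<open>Piecewise linear functions\<close>

text \<open>
  The piecewise linear function with slope \<open>p i\<close> on \<open>[i / n, (i + 1) / n]\<close>, written as a sum of ramps
  so that it is Lipschitz on the whole line.
\<close>

definition step_primitive :: "nat \<Rightarrow> (nat \<Rightarrow> real) \<Rightarrow> real \<Rightarrow> real" where
  "step_primitive n p x = (\<Sum>i<n. p i * max 0 (min 1 (real n * x - real i))) / real n"

lemma step_primitive_block:
  assumes "j < n" "x \<in> {real j / real n..real (Suc j) / real n}"
  shows "step_primitive n p x = ((\<Sum>i<j. p i) + p j * (real n * x - real j)) / real n"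
proof -
  have x: "real j \<le> real n * x" "real n * x \<le> real j + 1"
    using assms by (simp_all add: field_simps)
  have split: "(\<Sum>i<n. f i) = (\<Sum>i<j. f i) + f j + (\<Sum>i=Suc j..<n. f i)" for f :: "nat \<Rightarrow> real"
    using sum.atLeastLessThan_concat[of 0 j n f] sum.atLeast_Suc_lessThan[of j n f] assms(1)
    by (simp add: lessThan_atLeast0)
  have "(\<Sum>i<n. p i * max 0 (min 1 (real n * x - real i)))
      = (\<Sum>i<j. p i * max 0 (min 1 (real n * x - real i))) + p j * max 0 (min 1 (real n * x - real j))
        + (\<Sum>i=Suc j..<n. p i * max 0 (min 1 (real n * x - real i)))"
    by (rule split)
  also have "(\<Sum>i<j. p i * max 0 (min 1 (real n * x - real i))) = (\<Sum>i<j. p i)"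
  proof (rule sum.cong[OF refl])
    fix i assume "i \<in> {..<j}"
    then have "real i + 1 \<le> real j" by simp
    then show "p i * max 0 (min 1 (real n * x - real i)) = p i" using x by simp
  qed
  also have "(\<Sum>i=Suc j..<n. p i * max 0 (min 1 (real n * x - real i))) = 0"
  proof (intro sum.neutral ballI)
    fix i assume "i \<in> {Suc j..<n}"
    then have "real j + 1 \<le> real i" by simp
    then show "p i * max 0 (min 1 (real n * x - real i)) = 0" using x by simp
  qed
  also have "max 0 (min 1 (real n * x - real j)) = real n * x - real j" using x by simp
  finally show ?thesis unfolding step_primitive_def by simp
qed

lemma step_primitive_grid:
  assumes "j \<le> n" "n \<ge> 1"
  shows "step_primitive n p (real j / real n) = (\<Sum>i<j. p i) / real n"
proof (cases j)
  case 0
  then show ?thesis using step_primitive_block[of 0 n 0 p] assms by simp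
next
  case (Suc k)
  then show ?thesis
    using step_primitive_block[of k n "real j / real n" p] assms grid_point_bounds[of k n] by simp
qed

lemma step_primitive_DERIV:
  assumes "j < n" "x \<in> {real j / real n<..<real (Suc j) / real n}"
  shows "(step_primitive n p has_real_derivative p j) (at x)"
proof (rule has_field_derivative_transform_within_open)
  show "((\<lambda>x. ((\<Sum>i<j. p i) + p j * (real n * x - real j)) / real n) has_real_derivative p j) (at x)"
    using assms(1) by (auto intro!: derivative_eq_intros)
  show "((\<Sum>i<j. p i) + p j * (real n * y - real j)) / real n = step_primitive n p y"
    if "y \<in> {real j / real n<..<real (Suc j) / real n}" for y
    using that by (intro step_primitive_block[OF assms(1), symmetric]) auto
qed (use assms(2) in auto)

lemma unit_interval_block_cases:
  assumes "n \<ge> 1" "x \<in> {0..1}"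
  obtains j where "j \<le> n" "x = real j / real n"
    | j where "j < n" "x \<in> {real j / real n<..<real (Suc j) / real n}"
proof -
  define j where "j = nat \<lfloor>real n * x\<rfloor>"
  have j: "real j \<le> real n * x" "real n * x < real j + 1"
    using assms unfolding j_def by (auto simp: of_nat_nat)
  have "real n * x \<le> real n" using assms by (simp add: mult_left_le)
  then have "j \<le> n" using j by linarith
  show thesis
  proof (cases "real j = real n * x")
    case True
    then have "x = real j / real n" using assms by (simp add: field_simps)
    then show thesis using that(1) \<open>j \<le> n\<close> by blast
  next
    case False
    then have "real j < real n * x" using j by simp
    moreover from this have "j < n" using \<open>real n * x \<le> real n\<close> by linarith
    ultimately have "j < n" "x \<in> {real j / real n<..<real (Suc j) / real n}"
      using j assms by (simp_all add: field_simps)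
    then show thesis by (rule that(2))
  qed
qed

lemma step_primitive_admissible:
  assumes "n \<ge> 1" and p: "\<And>i. 0 \<le> p i \<and> p i \<le> 1"
  shows "step_primitive n p \<in> admissible"
proof -
  let ?g = "step_primitive n p"
  have "?g x \<in> {0..1}" for x
  proof -
    have "(\<Sum>i<n. p i * max 0 (min 1 (real n * x - real i))) \<le> (\<Sum>i<n. 1)"
      using p by (intro sum_mono mult_le_one) auto
    moreover have "0 \<le> (\<Sum>i<n. p i * max 0 (min 1 (real n * x - real i)))"
      using p by (intro sum_nonneg mult_nonneg_nonneg) auto
    ultimately show ?thesis unfolding step_primitive_def using \<open>n \<ge> 1\<close> by simp
  qed
  moreover have "?g 0 = 0" using step_primitive_grid[of 0 n p] assms by simp
  moreover have "abs_continuous_on_interval 0 1 ?g"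
  proof (rule lipschitz_imp_abs_continuous[where L = "real n"])
    fix x y
    have "\<bar>\<Sum>i<n. p i * max 0 (min 1 (real n * y - real i)) - p i * max 0 (min 1 (real n * x - real i))\<bar>
        \<le> (\<Sum>i<n. real n * \<bar>y - x\<bar>)"
    proof (intro order_trans[OF sum_abs] sum_mono)
      fix i
      have "\<bar>max 0 (min 1 (real n * y - real i)) - max 0 (min 1 (real n * x - real i))\<bar>
          \<le> \<bar>real n * y - real n * x\<bar>" by linarith
      also have "\<dots> = real n * \<bar>y - x\<bar>" by (simp add: abs_mult right_diff_distrib[symmetric])
      finally have "\<bar>p i\<bar> * \<bar>max 0 (min 1 (real n * y - real i)) - max 0 (min 1 (real n * x - real i))\<bar>
          \<le> 1 * (real n * \<bar>y - x\<bar>)"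
        using p[of i] by (intro mult_mono) auto
      then show "\<bar>p i * max 0 (min 1 (real n * y - real i)) - p i * max 0 (min 1 (real n * x - real i))\<bar>
          \<le> real n * \<bar>y - x\<bar>"
        by (simp only: right_diff_distrib[symmetric] abs_mult mult_1)
    qed
    then show "\<bar>?g y - ?g x\<bar> \<le> real n * \<bar>y - x\<bar>"
      unfolding step_primitive_def diff_divide_distrib[symmetric] sum_subtractf[symmetric]
      using \<open>n \<ge> 1\<close> by (simp add: field_simps)
  qed (use \<open>n \<ge> 1\<close> in simp)
  moreover have "AE x in lebesgue. x \<in> {0..1} \<longrightarrow>
      ?g differentiable (at x) \<and> 0 \<le> deriv ?g x \<and> deriv ?g x \<le> 1"
  proof (rule AE_I')
    show "(\<lambda>j. real j / real n) ` {..n} \<in> null_sets lebesgue"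
      by (simp add: negligible_iff_null_sets[symmetric] negligible_finite)
    show "{x \<in> space lebesgue. \<not> (x \<in> {0..1} \<longrightarrow>
        ?g differentiable (at x) \<and> 0 \<le> deriv ?g x \<and> deriv ?g x \<le> 1)} \<subseteq> (\<lambda>j. real j / real n) ` {..n}"
    proof
      fix x assume "x \<in> {x \<in> space lebesgue. \<not> (x \<in> {0..1} \<longrightarrow>
        ?g differentiable (at x) \<and> 0 \<le> deriv ?g x \<and> deriv ?g x \<le> 1)}"
      then have x: "x \<in> {0..1}"
        and bad: "\<not> (?g differentiable (at x) \<and> 0 \<le> deriv ?g x \<and> deriv ?g x \<le> 1)" by auto
      from unit_interval_block_cases[OF \<open>n \<ge> 1\<close> x] show "x \<in> (\<lambda>j. real j / real n) ` {..n}"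
      proof cases
        case (2 j)
        from step_primitive_DERIV[OF this, of p] have "?g differentiable (at x)" "deriv ?g x = p j"
          by (auto simp: DERIV_imp_deriv real_differentiable_def)
        then show ?thesis using bad p by auto
      qed auto
    qed
  qed
  ultimately show ?thesis unfolding admissible_def by auto
qed

text \<open>
  The entropy integral of a piecewise linear function is exactly its discrete counterpart, and the
  right Riemann sum of the energy is a lower sum. Hence the discrete functional is dominated without
  any error term.
\<close>

lemma step_primitive_growth_functional:
  assumes "n \<ge> 1" "\<beta> > 0" and p: "\<And>i. 0 \<le> p i \<and> p i \<le> 1"
  shows "discrete_functional \<rho> (\<beta> / (real n)\<^sup>2) n p \<le> real n * growth_functional \<rho> \<beta> (step_primitive n p)"
proof -
  let ?g = "step_primitive n p"
  have adm: "?g \<in> admissible" by (rule step_primitive_admissible) fact+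
  have g1: "?g 1 = (\<Sum>i<n. p i) / real n"
    using step_primitive_grid[of n n p] \<open>n \<ge> 1\<close> by simp
  have tail: "tail_sum p n m = real n * (?g 1 - ?g (real (Suc m) / real n))" if "m < n" for m
  proof -
    have "(\<Sum>i<n. p i) = (\<Sum>i<Suc m. p i) + tail_sum p n m"
    proof -
      have "{m<..<n} = {Suc m..<n}" by auto
      then show ?thesis
        using sum.atLeastLessThan_concat[of 0 "Suc m" n p] that
        unfolding tail_sum_def by (simp add: lessThan_atLeast0)
    qed
    moreover have "?g (real (Suc m) / real n) = (\<Sum>i<Suc m. p i) / real n"
      using that by (intro step_primitive_grid) auto
    ultimately show ?thesis unfolding g1 using \<open>n \<ge> 1\<close> by (simp add: field_simps)
  qed
  have "\<beta> / (real n)\<^sup>2 * (\<Sum>m<n. (tail_sum p n m)\<^sup>2)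
      = \<beta> * (\<Sum>m<n. (?g 1 - ?g (real (Suc m) / real n))\<^sup>2)"
  proof -
    have "(\<Sum>m<n. (tail_sum p n m)\<^sup>2) = (\<Sum>m<n. (real n)\<^sup>2 * (?g 1 - ?g (real (Suc m) / real n))\<^sup>2)"
      by (intro sum.cong[OF refl]) (simp add: tail power_mult_distrib)
    then show ?thesis using \<open>n \<ge> 1\<close> by (simp add: sum_distrib_left[symmetric])
  qed
  also have "\<dots> \<le> \<beta> * (real n * (LINT x:{0..1}|lebesgue. (?g 1 - ?g x)\<^sup>2))"
    using admissible_riemann_bounds(1)[OF adm \<open>n \<ge> 1\<close>] \<open>\<beta> > 0\<close> by (intro mult_left_mono) auto
  moreover have "real n * (LINT x:{0..1}|lebesgue. rate_fun (deriv ?g x)) = (\<Sum>i<n. rate_fun (p i))"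
  proof -
    obtain q N where q: "\<And>x. 0 \<le> q x \<and> q x \<le> 1" and N: "negligible N" "\<And>x. x \<in> {0..1} - N \<Longrightarrow> deriv ?g x = q x"
      and qint: "\<And>a b. 0 \<le> a \<Longrightarrow> a \<le> b \<Longrightarrow> b \<le> 1 \<Longrightarrow> (q has_integral (?g b - ?g a)) {a..b}"
      and ent: "(\<lambda>x. rate_fun (q x)) integrable_on {0..1}"
        "(LINT x:{0..1}|lebesgue. rate_fun (deriv ?g x)) = integral {0..1} (\<lambda>x. rate_fun (q x))"
      by (rule admissible_density[OF adm]) blast
    have "real n * integral {real i / real n..real (Suc i) / real n} (\<lambda>x. rate_fun (q x)) = rate_fun (p i)"
      if "i < n" for i
    proof -
      let ?I = "{real i / real n..real (Suc i) / real n}"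
      note gp = grid_point_bounds[OF that]
      have neg: "negligible (N \<union> {real i / real n, real (Suc i) / real n})" using N(1) by simp
      have "integral ?I (\<lambda>x. rate_fun (q x)) = integral ?I (\<lambda>_. rate_fun (p i))"
      proof (rule integral_spike[OF neg])
        fix x assume x: "x \<in> ?I - (N \<union> {real i / real n, real (Suc i) / real n})"
        then have "x \<in> {real i / real n<..<real (Suc i) / real n}" by auto
        from DERIV_imp_deriv[OF step_primitive_DERIV[OF that this]] have "deriv ?g x = p i" .
        moreover have "deriv ?g x = q x" using x gp(3) order_trans[OF gp(1), of x] by (intro N(2)) auto
        ultimately show "rate_fun (p i) = rate_fun (q x)" by simp
      qed
      then show ?thesis using gp(2,4) \<open>n \<ge> 1\<close> by simp
    qed
    then show ?thesis
      unfolding ent(2) integral_unit_interval_blocks[OF ent(1) \<open>n \<ge> 1\<close>] sum_distrib_left by simp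
  qed
  ultimately show ?thesis
    unfolding growth_functional_def discrete_functional_def g1 using \<open>n \<ge> 1\<close>
    by (simp add: algebra_simps)
qed

section \<open>The limit of the growth rates\<close>

lemma bdd_above_growth_functional:
  assumes "\<rho> > 0" "\<beta> > 0"
  shows "bdd_above (growth_functional \<rho> \<beta> ` admissible)"
proof (rule bdd_aboveI2)
  show "growth_functional \<rho> \<beta> g \<le> ln (partition_sum \<rho> (\<beta> / (real 1)\<^sup>2) 1) + \<beta>"
    if "g \<in> admissible" for g
    using growth_functional_le_ln_partition_sum[OF that _ assms, of 1] by simp
qed

text \<open>
  In the upper bound the block length \<open>b\<close> is about \<open>sqrt n\<close>. Then the quantisation error
  \<open>(\<beta> / n\<^sup>2) * n * b\<^sup>2\<close> stays bounded, and the logarithm \<open>(n / b + 1) * ln (n + 1)\<close> of the number of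
  step profiles is of order \<open>sqrt n * ln n\<close>; both are \<open>o(n)\<close>.
\<close>

lemma ln_partition_sum_bounds:
  assumes "\<rho> > 0" "\<beta> > 0" "n \<ge> 1"
  defines "V \<equiv> (SUP g\<in>admissible. growth_functional \<rho> \<beta> g)"
  shows "real n * V - \<beta> \<le> ln (partition_sum \<rho> (\<beta> / (real n)\<^sup>2) n)"
    and "ln (partition_sum \<rho> (\<beta> / (real n)\<^sup>2) n)
      \<le> real n * V + \<beta> * (sqrt (real n) + 1)\<^sup>2 / real n + (sqrt (real n) + 1) * ln (real n + 1)"
proof -
  let ?L = "ln (partition_sum \<rho> (\<beta> / (real n)\<^sup>2) n)"
  have "admissible \<noteq> {}" using step_primitive_admissible[of 1 "\<lambda>_. 0"] by auto
  then have "V \<le> (?L + \<beta>) / real n"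
    unfolding V_def
  proof (rule cSUP_least)
    fix g assume "g \<in> admissible"
    from growth_functional_le_ln_partition_sum[OF this assms(3,1,2)]
    show "growth_functional \<rho> \<beta> g \<le> (?L + \<beta>) / real n" using \<open>n \<ge> 1\<close> by (simp add: field_simps)
  qed
  then show "real n * V - \<beta> \<le> ?L" using \<open>n \<ge> 1\<close> by (simp add: field_simps)
  define b where "b = nat \<lceil>sqrt (real n)\<rceil>"
  have b: "sqrt (real n) \<le> real b" "real b \<le> sqrt (real n) + 1"
    unfolding b_def by (simp_all add: real_nat_ceiling_ge of_nat_nat)
  have s1: "1 \<le> sqrt (real n)" using \<open>n \<ge> 1\<close> by simp
  then have "b \<ge> 1" using b by linarith
  have "discrete_functional \<rho> (\<beta> / (real n)\<^sup>2) n p \<le> real n * V" if "\<And>i. 0 \<le> p i \<and> p i \<le> 1" for p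
  proof -
    have "growth_functional \<rho> \<beta> (step_primitive n p) \<le> V"
      unfolding V_def
      by (intro cSUP_upper step_primitive_admissible bdd_above_growth_functional assms that)
    then have "real n * growth_functional \<rho> \<beta> (step_primitive n p) \<le> real n * V"
      by (rule mult_left_mono) simp
    with step_primitive_growth_functional[where p = p, OF assms(3,2) that] show ?thesis
      by (rule order_trans)
  qed
  then have "?L \<le> real n * V + \<beta> / (real n)\<^sup>2 * real n * (real b)\<^sup>2 + real (n div b + 1) * ln (real n + 1)"
    using assms \<open>b \<ge> 1\<close> by (intro ln_partition_sum_le) auto
  also have "\<beta> / (real n)\<^sup>2 * real n * (real b)\<^sup>2 \<le> \<beta> * (sqrt (real n) + 1)\<^sup>2 / real n"
  proof -
    have "\<beta> / (real n)\<^sup>2 * real n * (real b)\<^sup>2 = \<beta> * (real b)\<^sup>2 / real n"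
      using \<open>n \<ge> 1\<close> by (simp add: power2_eq_square)
    also have "\<dots> \<le> \<beta> * (sqrt (real n) + 1)\<^sup>2 / real n"
      using b \<open>\<beta> > 0\<close> by (intro divide_right_mono mult_left_mono power_mono) auto
    finally show ?thesis .
  qed
  also have "real (n div b + 1) * ln (real n + 1) \<le> (sqrt (real n) + 1) * ln (real n + 1)"
  proof (rule mult_right_mono)
    have "real (n div b) \<le> real n / real b" by (rule of_nat_div_le_of_nat)
    also have "\<dots> \<le> real n / sqrt (real n)"
      using b s1 \<open>b \<ge> 1\<close> by (intro divide_left_mono mult_pos_pos) auto
    also have "\<dots> = sqrt (real n)" by (simp add: real_div_sqrt)
    finally show "real (n div b + 1) \<le> sqrt (real n) + 1" by simp
  qed simp
  finally show "?L \<le> real n * V + \<beta> * (sqrt (real n) + 1)\<^sup>2 / real n + (sqrt (real n) + 1) * ln (real n + 1)"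
    by simp
qed

theorem theorem1:
  fixes M :: "'a measure" and W :: "real \<Rightarrow> 'a \<Rightarrow> real"
    and \<sigma> \<tau> :: "nat \<Rightarrow> real" and \<rho> \<beta> x0 :: real
  assumes "\<rho> > 0" and "\<beta> > 0" and "x0 > 0"
    and "standard_brownian_motion M W"
    and "\<And>n. n \<ge> 1 \<Longrightarrow> \<sigma> n > 0"
    and "\<And>n. n \<ge> 1 \<Longrightarrow> \<tau> n > 0"
    and "\<And>n. n \<ge> 1 \<Longrightarrow> 1 / 2 * (\<sigma> n)\<^sup>2 * \<tau> n * (real n)\<^sup>2 = \<beta>"
  shows "(\<forall>n\<ge>1. integrable M (growth_process \<rho> x0 (\<sigma> n) (\<tau> n) W n)) \<and>
    bdd_above (growth_functional \<rho> \<beta> ` admissible) \<and>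
    (\<lambda>n. 1 / real n *
        ln (prob_space.expectation M (growth_process \<rho> x0 (\<sigma> n) (\<tau> n) W n)))
      \<longlonglongrightarrow> (SUP g\<in>admissible. growth_functional \<rho> \<beta> g)"
proof (intro conjI allI impI)
  show "integrable M (growth_process \<rho> x0 (\<sigma> n) (\<tau> n) W n)" if "n \<ge> 1" for n
    using assms(4) assms(6)[OF that] by (rule growth_process_moment(1))
  show "bdd_above (growth_functional \<rho> \<beta> ` admissible)"
    by (rule bdd_above_growth_functional) fact+
  define V where "V = (SUP g\<in>admissible. growth_functional \<rho> \<beta> g)"
  define E where "E n = prob_space.expectation M (growth_process \<rho> x0 (\<sigma> n) (\<tau> n) W n)" for n
  define lo where "lo n = V + (ln x0 - 2 * \<beta>) / real n" for n
  define hi where "hi n = V + (ln x0 + \<beta> * (sqrt (real n) + 1)\<^sup>2 / real n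
    + (sqrt (real n) + 1) * ln (real n + 1)) / real n" for n
  have bounds: "lo n \<le> 1 / real n * ln (E n) \<and> 1 / real n * ln (E n) \<le> hi n" if "n \<ge> 1" for n
  proof -
    let ?L = "ln (partition_sum \<rho> (\<beta> / (real n)\<^sup>2) n)"
    have "?L - \<beta> + ln x0 \<le> ln (E n)" "ln (E n) \<le> ?L + ln x0"
      using ln_growth_process_moment_bounds[OF assms(4) assms(6)[OF that] assms(1,3,2) that assms(7)[OF that]]
      unfolding E_def by auto
    then have "real n * V + (ln x0 - 2 * \<beta>) \<le> ln (E n)"
      "ln (E n) \<le> real n * V + (ln x0 + \<beta> * (sqrt (real n) + 1)\<^sup>2 / real n
         + (sqrt (real n) + 1) * ln (real n + 1))"
      using ln_partition_sum_bounds[OF assms(1,2) that] unfolding V_def by linarith+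
    then have "(real n * V + (ln x0 - 2 * \<beta>)) / real n \<le> ln (E n) / real n"
      "ln (E n) / real n \<le> (real n * V + (ln x0 + \<beta> * (sqrt (real n) + 1)\<^sup>2 / real n
         + (sqrt (real n) + 1) * ln (real n + 1))) / real n"
      by (intro divide_right_mono; simp)+
    then show ?thesis unfolding lo_def hi_def using that by (simp add: add_divide_distrib)
  qed
  have "lo \<longlonglongrightarrow> V" unfolding lo_def by real_asymp
  moreover have "hi \<longlonglongrightarrow> V" unfolding hi_def by real_asymp
  ultimately have "(\<lambda>n. 1 / real n * ln (E n)) \<longlonglongrightarrow> V"
    by (rule tendsto_sandwich[rotated 2]) (use bounds in \<open>auto intro: eventually_sequentiallyI[of 1]\<close>)
  then show "(\<lambda>n. 1 / real n *
        ln (prob_space.expectation M (growth_process \<rho> x0 (\<sigma> n) (\<tau> n) W n)))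
      \<longlonglongrightarrow> (SUP g\<in>admissible. growth_functional \<rho> \<beta> g)"
    unfolding E_def V_def .
qed

end
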